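(* There exist an integer $n\ge 1$ and a dynamical system on $\mathbb{R}^n$ (discrete-time or continuous-time) defined by an analytic and computable function $f:\mathbb{R}^n\to\mathbb{R}^n$, which admits a computable hyperbolic sink $s$, such that the basin of attraction of $s$ is not computable.
   Context: Dynamical systems. A function $f:\mathbb{R}^n\to\mathbb{R}^n$ defines a discrete-time dynamical system, in which the trajectory starting at $x_0$ is the sequence of iterates $x_0, f(x_0), f(f(x_0)),\ldots$, or a continuous-time dynamical system, in which the trajectory starting at $x_0$ is the solution of $x'=f(x)$, $x(0)=x_0$. A fixed point (equilibrium) is a point $s$ with $f(s)=s$ (discrete-time) or $f(s)=0$ (continuous-time). The basin of attraction of $s$ is the set of all $x$ such that the trajectory starting at $x$ converges to $s$ as time tends to $\infty$. A fixed point $s$ is a sink if some neighborhood of $s$ is contained in its basin of attraction. A sink $s$ is hyperbolic if all eigenvalues of the Jacobian $Df(s)$ have absolute value $<1$ (discrete-time), respectively negative real part (continuous-time). The basin of attraction of a hyperbolic sink is an open set. Analytic means real analytic. Computability. An oracle for a real number $x$ is a function $\phi:\mathbb{N}\to\mathbb{Q}$ with $|x-\phi(k)|\le 2^{-k}$ for all $k\in\mathbb{N}$; an oracle for a point of $\mathbb{R}^n$ is a tuple of oracles for its coordinates. A point of $\mathbb{R}^n$ is computable if some Turing machine computes an oracle for it. A function $F:\mathbb{R}^n\to\mathbb{R}^p$ is computable if there is an oracle Turing machine which, given any oracle for any $x\in\mathbb{R}^n$ and on input $k\in\mathbb{N}$, outputs a rational vector whose coordinates approximate those of $F(x)$ with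 error less than $2^{-k}$. An open set $O\subseteq\mathbb{R}^n$ is computable if the distance function $d_{\mathbb{R}^n\setminus O}:\mathbb{R}^n\to\mathbb{R}$, $d_{\mathbb{R}^n\setminus O}(x)=\inf_{y\in\mathbb{R}^n\setminus O}d(x,y)$, is computable, where $d$ is the usual distance on $\mathbb{R}^n$. *)

theory Defs
  imports
    "HOL-Analysis.Derivative"
    "HOL-Analysis.Infinite_Sum"
    "Jordan_Normal_Form.Char_Poly"
begin

hide_type (open) Finite_Cartesian_Product.vec
hide_const (open) Finite_Cartesian_Product.vec
no_notation vec_nth (infixl \<open>$\<close> 90)

text \<open>
  The space \<open>\<real>\<^sup>n\<close> is \<^term>\<open>carrier_vec n :: real vec set\<close>, because \<open>n\<close> is quantified inside the
  theorem. Functions on \<open>\<real>\<^sup>n\<close> are only ever evaluated on this carrier.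
\<close>

section \<open>Analytic functions and dynamical systems\<close>

definition edist :: "real vec \<Rightarrow> real vec \<Rightarrow> real" where
  "edist x y = sqrt (\<Sum>i<dim_vec x. (x $ i - y $ i)\<^sup>2)"

text \<open>
  Around every point each component is the sum of a convergent power series in \<open>n\<close> variables.
  The multi-indices are the vectors of natural numbers of length \<open>n\<close>; the sum is unordered,
  hence absolutely convergent.
\<close>

definition real_analytic :: "nat \<Rightarrow> nat \<Rightarrow> (real vec \<Rightarrow> real vec) \<Rightarrow> bool" where
  "real_analytic n p f \<longleftrightarrow>
     (\<forall>a \<in> carrier_vec n. \<forall>i<p. \<exists>(c :: nat vec \<Rightarrow> real) r. r > 0 \<and>
        (\<forall>x \<in> carrier_vec n. edist x a < r \<longrightarrow>
           ((\<lambda>\<alpha>. c \<alpha> * (\<Prod>j<n. (x $ j - a $ j) ^ (\<alpha> $ j))) has_sum f x $ i) (carrier_vec n)))"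

definition jacobian :: "nat \<Rightarrow> (real vec \<Rightarrow> real vec) \<Rightarrow> real vec \<Rightarrow> real mat" where
  "jacobian n f x = mat n n (\<lambda>(i, j). deriv (\<lambda>t. f (x + t \<cdot>\<^sub>v unit_vec n j) $ i) 0)"

datatype time = Discrete | Continuous

definition solution_from ::
    "nat \<Rightarrow> (real vec \<Rightarrow> real vec) \<Rightarrow> real vec \<Rightarrow> (real \<Rightarrow> real vec) \<Rightarrow> bool" where
  "solution_from n f x\<^sub>0 x \<longleftrightarrow>
     x 0 = x\<^sub>0 \<and>
     (\<forall>t\<ge>0. x t \<in> carrier_vec n \<and>
        (\<forall>i<n. ((\<lambda>u. x u $ i) has_real_derivative f (x t) $ i) (at t within {0..})))"

fun fixed_point :: "time \<Rightarrow> nat \<Rightarrow> (real vec \<Rightarrow> real vec) \<Rightarrow> real vec \<Rightarrow> bool" where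
  "fixed_point Discrete n f s \<longleftrightarrow> s \<in> carrier_vec n \<and> f s = s"
| "fixed_point Continuous n f s \<longleftrightarrow> s \<in> carrier_vec n \<and> f s = 0\<^sub>v n"

text \<open>
  In continuous time a trajectory can only converge as time tends to infinity if it exists for all
  \<open>t \<ge> 0\<close>. For analytic \<open>f\<close> it is then unique, so the existential quantifier speaks
  about \<^emph>\<open>the\<close> trajectory.
\<close>

fun basin :: "time \<Rightarrow> nat \<Rightarrow> (real vec \<Rightarrow> real vec) \<Rightarrow> real vec \<Rightarrow> real vec set" where
  "basin Discrete n f s =
     {x \<in> carrier_vec n. (\<lambda>k. edist ((f ^^ k) x) s) \<longlonglongrightarrow> 0}"
| "basin Continuous n f s =
     {x\<^sub>0 \<in> carrier_vec n.
        \<exists>x. solution_from n f x\<^sub>0 x \<and> ((\<lambda>t. edist (x t) s) \<longlongrightarrow> 0) at_top}"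

definition sink :: "time \<Rightarrow> nat \<Rightarrow> (real vec \<Rightarrow> real vec) \<Rightarrow> real vec \<Rightarrow> bool" where
  "sink T n f s \<longleftrightarrow>
     fixed_point T n f s \<and>
     (\<exists>\<epsilon>>0. \<forall>x \<in> carrier_vec n. edist x s < \<epsilon> \<longrightarrow> x \<in> basin T n f s)"

fun stable_eigenvalue :: "time \<Rightarrow> complex \<Rightarrow> bool" where
  "stable_eigenvalue Discrete \<mu> \<longleftrightarrow> cmod \<mu> < 1"
| "stable_eigenvalue Continuous \<mu> \<longleftrightarrow> Re \<mu> < 0"

definition hyperbolic_sink :: "time \<Rightarrow> nat \<Rightarrow> (real vec \<Rightarrow> real vec) \<Rightarrow> real vec \<Rightarrow> bool" where
  "hyperbolic_sink T n f s \<longleftrightarrow>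
     sink T n f s \<and>
     (\<forall>\<mu>. eigenvalue (map_mat complex_of_real (jacobian n f s)) \<mu> \<longrightarrow> stable_eigenvalue T \<mu>)"


section \<open>Oracle Turing machines\<close>

text \<open>
  Deterministic multi-tape machines with two-way infinite tapes. Tape symbols and states are
  natural numbers below bounds given by the machine, so that the relevant part of the transition
  table is finite; the start state is \<open>0\<close>. In a given state and for given scanned
  symbols, a machine halts, or queries one of its oracles and enters a new state, or writes a symbol
  and moves the head on every tape and enters a new state.

  Tape 0 is the input tape, tape 1 the output tape, tape 2 the query tape and tape 3 the answer
  tape; further tapes are work tapes.
\<close>

datatype direction = Left | Stay | Right

datatype action =
    Halt
  | Query nat nat  \<comment> \<open>index of the oracle, next state\<close>
  | Move nat "(nat \<times> direction) list"  \<comment> \<open>next state, symbol to write and head move for each tape\<close>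

record machine =
  num_tapes :: nat
  num_states :: nat
  num_symbols :: nat
  delta :: "nat \<Rightarrow> nat list \<Rightarrow> action"

abbreviation (input) "blank \<equiv> 0 :: nat"
abbreviation (input) "stroke \<equiv> 1 :: nat"
abbreviation (input) "minus_sign \<equiv> 2 :: nat"
abbreviation (input) "slash \<equiv> 3 :: nat"
abbreviation (input) "end_mark \<equiv> 4 :: nat"

fun valid_action :: "nat \<Rightarrow> machine \<Rightarrow> action \<Rightarrow> bool" where
  "valid_action m M Halt \<longleftrightarrow> True"
| "valid_action m M (Query i q) \<longleftrightarrow> i < m \<and> q < num_states M"
| "valid_action m M (Move q ws) \<longleftrightarrow>
     q < num_states M \<and> length ws = num_tapes M \<and> (\<forall>(w, d) \<in> set ws. w < num_symbols M)"

text \<open>A machine with \<open>m\<close> oracles. For \<open>m = 0\<close> this is an ordinary Turing machine.\<close>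

definition oracle_machine :: "nat \<Rightarrow> machine \<Rightarrow> bool" where
  "oracle_machine m M \<longleftrightarrow>
     num_tapes M \<ge> 4 \<and> num_symbols M \<ge> 5 \<and> num_states M \<ge> 1 \<and>
     (\<forall>q < num_states M. \<forall>as.
        length as = num_tapes M \<and> (\<forall>a \<in> set as. a < num_symbols M) \<longrightarrow>
        valid_action m M (delta M q as))"

record config =
  state :: nat
  cells :: "nat \<Rightarrow> int \<Rightarrow> nat"
  head :: "nat \<Rightarrow> int"

definition word_tape :: "nat list \<Rightarrow> int \<Rightarrow> nat" where
  "word_tape w j = (if 0 \<le> j \<and> j < int (length w) then w ! nat j else blank)"

text \<open>
  Natural numbers are written in unary. The fraction \<open>a / b\<close> is written as an optional minus sign,
  \<open>\<bar>a\<bar>\<close> strokes, a slash, \<open>b\<close> strokes and an end mark.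
\<close>

definition nat_word :: "nat \<Rightarrow> nat list" where
  "nat_word k = replicate k stroke"

fun fraction_word :: "int \<times> int \<Rightarrow> nat list" where
  "fraction_word (a, b) =
     (if a < 0 then [minus_sign] else []) @ nat_word (nat \<bar>a\<bar>) @ [slash] @ nat_word (nat b) @ [end_mark]"

fun fraction_value :: "int \<times> int \<Rightarrow> rat" where
  "fraction_value (a, b) = of_int a / of_int b"

definition scanned :: "machine \<Rightarrow> config \<Rightarrow> nat list" where
  "scanned M c = map (\<lambda>j. cells c j (head c j)) [0..<num_tapes M]"

text \<open>
  The number queried is the number of consecutive strokes on the query tape from cell \<open>0\<close> on; only
  finitely many cells of a tape are non-blank, so the \<open>LEAST\<close> exists.
\<close>

definition query_number :: "config \<Rightarrow> nat" where
  "query_number c = (LEAST k. cells c 2 (int k) \<noteq> stroke)"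

fun shift :: "direction \<Rightarrow> int" where
  "shift Left = -1"
| "shift Stay = 0"
| "shift Right = 1"

text \<open>
  The oracle's answer replaces the content of the answer tape, as a fraction in lowest terms, and
  the head of that tape returns to cell \<open>0\<close>. A halted machine stays in its configuration.
\<close>

definition step :: "machine \<Rightarrow> (nat \<Rightarrow> nat \<Rightarrow> rat) \<Rightarrow> config \<Rightarrow> config" where
  "step M \<phi> c = (case delta M (state c) (scanned M c) of
       Halt \<Rightarrow> c
     | Query i q \<Rightarrow>
         c\<lparr>state := q,
           cells := (cells c)(3 := word_tape (fraction_word (quotient_of (\<phi> i (query_number c))))),
           head := (head c)(3 := 0)\<rparr>
     | Move q ws \<Rightarrow>
         \<lparr>state = q,
          cells = (\<lambda>j. if j < num_tapes M then (cells c j)(head c j := fst (ws ! j)) else cells c j),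
          head = (\<lambda>j. if j < num_tapes M then head c j + shift (snd (ws ! j)) else head c j)\<rparr>)"

definition initial :: "nat \<Rightarrow> config" where
  "initial k = \<lparr>state = 0, cells = (\<lambda>j. word_tape (if j = 0 then nat_word k else [])), head = (\<lambda>_. 0)\<rparr>"

definition halted :: "machine \<Rightarrow> config \<Rightarrow> bool" where
  "halted M c \<longleftrightarrow> delta M (state c) (scanned M c) = Halt"

text \<open>
  On input \<open>k\<close> and with the oracles \<open>\<phi> 0, \<phi> 1, \<dots>\<close> the machine halts with the words for
  the components of the rational vector \<open>qs\<close> on the output tape. The fractions need not be in lowest
  terms.
\<close>

definition outputs :: "machine \<Rightarrow> (nat \<Rightarrow> nat \<Rightarrow> rat) \<Rightarrow> nat \<Rightarrow> rat list \<Rightarrow> bool" where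
  "outputs M \<phi> k qs \<longleftrightarrow>
     (\<exists>t fs. let c = (step M \<phi> ^^ t) (initial k) in
        halted M c \<and> (\<forall>(a, b) \<in> set fs. b > 0) \<and>
        cells c 1 = word_tape (concat (map fraction_word fs)) \<and> qs = map fraction_value fs)"


section \<open>Computability over the reals\<close>

definition is_oracle :: "(nat \<Rightarrow> rat) \<Rightarrow> real \<Rightarrow> bool" where
  "is_oracle \<phi> x \<longleftrightarrow> (\<forall>k. \<bar>x - of_rat (\<phi> k)\<bar> \<le> 1 / 2 ^ k)"

definition is_oracle_vec :: "nat \<Rightarrow> (nat \<Rightarrow> nat \<Rightarrow> rat) \<Rightarrow> real vec \<Rightarrow> bool" where
  "is_oracle_vec n \<phi> x \<longleftrightarrow> (\<forall>i<n. is_oracle (\<phi> i) (x $ i))"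

text \<open>A machine without oracles never uses the family of oracles it is run with.\<close>

definition computable_point :: "nat \<Rightarrow> real vec \<Rightarrow> bool" where
  "computable_point n x \<longleftrightarrow>
     (\<exists>M \<phi>. oracle_machine 0 M \<and> is_oracle_vec n \<phi> x \<and>
        (\<forall>k. outputs M (\<lambda>_ _. 0) k (map (\<lambda>i. \<phi> i k) [0..<n])))"

definition computable_function :: "nat \<Rightarrow> nat \<Rightarrow> (real vec \<Rightarrow> real vec) \<Rightarrow> bool" where
  "computable_function n p F \<longleftrightarrow>
     (\<exists>M. oracle_machine n M \<and>
        (\<forall>x \<in> carrier_vec n. \<forall>\<phi>. is_oracle_vec n \<phi> x \<longrightarrow>
           (\<forall>k. \<exists>qs. outputs M \<phi> k qs \<and> length qs = p \<and>
              (\<forall>i<p. \<bar>of_rat (qs ! i) - F x $ i\<bar> < 1 / 2 ^ k))))"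

text \<open>
  The distance to the empty set is \<open>0\<close> by convention, as for \<^const>\<open>infdist\<close>, so that the whole
  space is a computable open set.
\<close>

definition set_distance :: "real vec set \<Rightarrow> real vec \<Rightarrow> real" where
  "set_distance A x = (if A = {} then 0 else (INF y\<in>A. edist x y))"

text \<open>
  Only meaningful for open \<open>U \<subseteq> \<real>\<^sup>n\<close>. Openness is not part of the definition, lest its negation be
  satisfied by a set that fails to be open.
\<close>

definition computable_open_set :: "nat \<Rightarrow> real vec set \<Rightarrow> bool" where
  "computable_open_set n U \<longleftrightarrow>
     computable_function n 1 (\<lambda>x. vec 1 (\<lambda>_. set_distance (carrier_vec n - U) x))"

end

theory Submission
  imports Defs "HOL-Complex_Analysis.Complex_Analysis"
begin

no_notation fps_nth (infixl \<open>$\<close> 75)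
no_notation vec_nth (infixl \<open>$\<close> 90)
hide_type (open) Finite_Cartesian_Product.vec
hide_const (open) Finite_Cartesian_Product.vec

text \<open>
  The system is \<open>f (x, u) = (0, g u * W x)\<close> in discrete time, with \<open>g u = 2 * u / (1 + u\<^sup>2)\<close> and
  \<open>W x = (\<Prod>e. (1 - x / 2 ^ (e + 2))\<^sup>2 + b e * (x / 2 ^ (e + 2))\<^sup>2)\<close> for numbers \<open>0 \<le> b e \<le> 1\<close>. Since
  \<open>W 0 = 1\<close>, after one step only \<open>g\<close> acts; it fixes \<open>1\<close>, where its derivative vanishes, and it
  attracts exactly the positive numbers to \<open>1\<close>. So \<open>(0, 1)\<close> is a hyperbolic sink with basin
  \<open>{(x, u). u > 0 \<and> W x > 0}\<close>, and the point \<open>(2 ^ (e + 2), 2)\<close> has distance \<open>0\<close> or at least \<open>2\<close> from the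
  complement of the basin, depending on whether \<open>b e = 0\<close> or not.

  Now let \<open>b e\<close> be the sum of \<open>1 / 2 ^ (t + 1)\<close> over the \<open>t\<close> that witness that the machine with
  code \<open>e\<close>, given that very point, halts with output less than \<open>1\<close>. Then \<open>f\<close> is computable because
  being a witness is decidable, but a machine that computes the distance to the complement of the basin is wrong
  at the point that belongs to its own code.
\<close>

text \<open>Whether \<open>b e = 0\<close> is only semi-decidable, yet \<open>f\<close> must be
  computable at every point. Putting \<open>b e\<close> into \<open>W\<close> as a real coefficient
  resolves this: testing all \<open>t < m\<close> gives it up to \<open>1 / 2 ^ m\<close>, and
  whether it vanishes is never asked. A witness \<open>t\<close> codes a number of steps together
  with a position on the output tape, so bounded simulation decides it; only primitive recursive
  functions have to be compiled, with no unbounded search. A factor of \<open>W\<close> is a square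
  plus a nonnegative multiple of a square. It never changes sign, and at \<open>2 ^ (e + 2)\<close>
  it is zero exactly if the coefficient is. Then the whole vertical line over
  \<open>2 ^ (e + 2)\<close> is sent to the fixed point \<open>0\<close> of \<open>g\<close> and
  drops out of the basin. The powers of two serve three ends: the factors tend to \<open>1\<close>
  geometrically on every disc, so \<open>W\<close> is entire with explicit error bounds; the
  possible lines are at least \<open>4\<close> apart, so other lines do not disturb the distance at
  a given point; and all of them stay away from the sink. The height \<open>2\<close> keeps the
  point at distance \<open>2\<close> from the half-plane \<open>u \<le> 0\<close>. Thus an
  approximation with error below \<open>1\<close> must tell the two cases apart.\<close>

section \<open>A structured language for oracle machines\<close>

datatype com =
    Act nat nat direction
  | Ask nat
  | Seq com com (infixr \<open>;;\<close> 60)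
  | While nat nat com

text \<open>Countability lets \<open>to_nat\<close> number stacks of commands, which become machine
  states.\<close>

instance direction :: countable
  by countable_datatype

instance com :: countable
  by countable_datatype

type_synonym mem = "(nat \<Rightarrow> int \<Rightarrow> nat) \<times> (nat \<Rightarrow> int)"

text \<open>A relation, since loops may diverge. The rules for \<open>Act\<close> and
  \<open>Ask\<close> mirror \<open>step\<close>, including the return of the answer head to cell
  0.\<close>

inductive exec :: "(nat \<Rightarrow> nat \<Rightarrow> rat) \<Rightarrow> com \<Rightarrow> mem \<Rightarrow> mem \<Rightarrow> bool" for \<phi> where
  Act: "exec \<phi> (Act j w d) (C, H) (C(j := (C j)(H j := w)), H(j := H j + shift d))"
| Ask: "exec \<phi> (Ask i) (C, H)
    (C(3 := word_tape (fraction_word (quotient_of (\<phi> i (LEAST k. C 2 (int k) \<noteq> stroke))))), H(3 := 0))"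
| Seq: "exec \<phi> a s s' \<Longrightarrow> exec \<phi> b s' s'' \<Longrightarrow> exec \<phi> (a ;; b) s s''"
| WhileF: "C j (H j) \<noteq> x \<Longrightarrow> exec \<phi> (While j x a) (C, H) (C, H)"
| WhileT: "C j (H j) = x \<Longrightarrow> exec \<phi> a (C, H) s' \<Longrightarrow> exec \<phi> (While j x a) s' s'' \<Longrightarrow>
    exec \<phi> (While j x a) (C, H) s''"

fun wf_com :: "nat \<Rightarrow> com \<Rightarrow> bool" where
  "wf_com m (Act j w d) \<longleftrightarrow> w < 5"
| "wf_com m (Ask i) \<longleftrightarrow> i < m"
| "wf_com m (a ;; b) \<longleftrightarrow> wf_com m a \<and> wf_com m b"
| "wf_com m (While j x a) \<longleftrightarrow> wf_com m a"

lemma wf_com_mono: "wf_com m a \<Longrightarrow> m \<le> m' \<Longrightarrow> wf_com m' a"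
  by (induction a) auto

fun tapes :: "com \<Rightarrow> nat" where
  "tapes (Act j w d) = max 4 (Suc j)"
| "tapes (Ask i) = 4"
| "tapes (a ;; b) = max (tapes a) (tapes b)"
| "tapes (While j x a) = max (Suc j) (tapes a)"

lemma tapes_ge: "4 \<le> tapes a"
  by (induction a) auto

text \<open>
  A state of the machine is the stack of commands still to be executed; only finitely many stacks
  are reachable.
\<close>

fun stacks :: "com \<Rightarrow> com list \<Rightarrow> com list set" where
  "stacks (Act j w d) k = {Act j w d # k}"
| "stacks (Ask i) k = {Ask i # k}"
| "stacks (a ;; b) k = insert ((a ;; b) # k) (stacks a (b # k) \<union> stacks b k)"
| "stacks (While j x a) k = insert (While j x a # k) (stacks a (While j x a # k))"

fun succs :: "com list \<Rightarrow> com list set" where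
  "succs [] = {}"
| "succs ((a ;; b) # k) = {a # b # k}"
| "succs (While j x a # k) = {a # While j x a # k, k}"
| "succs (_ # k) = {k}"

lemma finite_stacks: "finite (stacks a k)"
  by (induction a k rule: stacks.induct) auto

lemma stacks_start: "a # k \<in> stacks a k"
  by (cases a) auto

lemma stacks_succs: "s \<in> stacks a k \<Longrightarrow> succs s \<subseteq> insert k (stacks a k)"
proof (induction a k arbitrary: s rule: stacks.induct)
  case (3 a b k)
  then show ?case using stacks_start[of a "b # k"] stacks_start[of b k] by fastforce
next
  case (4 j x a k)
  then show ?case using stacks_start[of a "While j x a # k"] by fastforce
qed auto

text \<open>When the command on top has finished, execution continues with the rest of the stack, so
  the rest must have a state as well.\<close>

lemma stacks_tl: "x # l \<in> stacks a k \<Longrightarrow> l \<in> insert k (stacks a k)"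
proof (induction a k arbitrary: x l rule: stacks.induct)
  case (3 a b k)
  then show ?case using stacks_start[of b k] by auto
qed auto

lemma stacks_ok:
  "s \<in> stacks a k \<Longrightarrow> \<forall>x\<in>set (a # k). wf_com m x \<and> tapes x \<le> n \<Longrightarrow> \<forall>x\<in>set s. wf_com m x \<and> tapes x \<le> n"
  by (induction a k arbitrary: s rule: stacks.induct) auto

definition reach :: "com \<Rightarrow> com list set" where
  "reach a = insert [] (stacks a [])"

lemma finite_reach: "finite (reach a)"
  by (simp add: reach_def finite_stacks)

lemma reach_succs: "s \<in> reach a \<Longrightarrow> s' \<in> succs s \<Longrightarrow> s' \<in> reach a"
  using stacks_succs[of s a "[]"] by (auto simp: reach_def)

lemma reach_tl: "x # l \<in> reach a \<Longrightarrow> l \<in> reach a"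
  using stacks_tl[of x l a "[]"] by (auto simp: reach_def)

text \<open>The transposition exchanges the number of the initial stack with 0, because a machine
  starts in state 0.\<close>

definition code :: "com \<Rightarrow> com list \<Rightarrow> nat" where
  "code a s = Transposition.transpose 0 (to_nat [a]) (to_nat s)"

lemma code_eq_iff: "code a s = code a s' \<longleftrightarrow> s = s'"
  by (auto simp: code_def dest: transpose_eq_imp_eq)

lemma code_start: "code a [a] = 0"
  by (simp add: code_def)

text \<open>Sequencing and loop tests cost a step of their own, which writes the scanned symbols
  back and moves no head, so that only the state changes.\<close>

fun act :: "com \<Rightarrow> com list \<Rightarrow> nat list \<Rightarrow> action" where
  "act c [] as = Halt"
| "act c (Act j w d # k) as = Move (code c k) ((map (\<lambda>a. (a, Stay)) as)[j := (w, d)])"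
| "act c (Ask i # k) as = Query i (code c k)"
| "act c ((a ;; b) # k) as = Move (code c (a # b # k)) (map (\<lambda>a. (a, Stay)) as)"
| "act c (While j x a # k) as =
    Move (code c (if as ! j = x then a # While j x a # k else k)) (map (\<lambda>a. (a, Stay)) as)"

text \<open>The codes of reachable stacks need not be contiguous; the states in between simply
  halt.\<close>

definition machine_of :: "com \<Rightarrow> machine" where
  "machine_of c = \<lparr>num_tapes = tapes c, num_states = Suc (Max (code c ` reach c)), num_symbols = 5,
     delta = (\<lambda>q as. if q \<in> code c ` reach c then act c (inv_into UNIV (code c) q) as else Halt)\<rparr>"

lemma delta_machine_of:
  assumes "s \<in> reach c"
  shows "delta (machine_of c) (code c s) as = act c s as"
proof -
  have "inj (code c)" by (simp add: inj_on_def code_eq_iff)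
  then show ?thesis using assms by (simp add: machine_of_def)
qed

lemma code_less: "s \<in> reach c \<Longrightarrow> code c s < num_states (machine_of c)"
  by (simp add: machine_of_def less_Suc_eq_le finite_reach)

lemma oracle_machine_of:
  assumes "wf_com m c"
  shows "oracle_machine m (machine_of c)"
proof -
  have "valid_action m (machine_of c) (delta (machine_of c) q as)"
    if as: "length as = tapes c" "\<forall>a\<in>set as. a < 5" for q as
  proof (cases "q \<in> code c ` reach c")
    case True
    then obtain s where s: "s \<in> reach c" and q: "q = code c s" by blast
    have ok: "\<forall>x\<in>set s. wf_com m x \<and> tapes x \<le> tapes c"
      using s stacks_ok[of s c "[]" m "tapes c"] assms by (auto simp: reach_def)
    have less: "code c s' < num_states (machine_of c)" if "s' \<in> succs s" for s'
      using code_less reach_succs[OF s that] .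
    have n: "num_tapes (machine_of c) = tapes c" "num_symbols (machine_of c) = 5"
      by (simp_all add: machine_of_def)
    have upd: "a < 5" if "w < 5" "(a, b) \<in> set ((map (\<lambda>a. (a, Stay)) as)[j := (w, d)])" for j w d a b
      using that as(2) set_update_subset_insert[of "map (\<lambda>a. (a, Stay)) as" j "(w, d)"] by fastforce
    have "valid_action m (machine_of c) (act c s as)"
      using ok less as upd
      by (cases "(c, s, as)" rule: act.cases)
        (auto simp: n split: if_splits)
    then show ?thesis using delta_machine_of[OF s] q by simp
  next
    case False
    then show ?thesis by (simp add: machine_of_def)
  qed
  then show ?thesis
    using tapes_ge[of c] by (simp add: oracle_machine_def machine_of_def)
qed

lemma nth_scanned: "j < num_tapes M \<Longrightarrow> scanned M \<lparr>state = q, cells = C, head = H\<rparr> ! j = C j (H j)"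
  by (simp add: scanned_def)

lemma reach_ok: "s \<in> reach c \<Longrightarrow> wf_com m c \<Longrightarrow> x \<in> set s \<Longrightarrow> wf_com m x \<and> tapes x \<le> tapes c"
  using stacks_ok[of s c "[]" m "tapes c"] by (auto simp: reach_def)

text \<open>Induction on the big-step derivation for an arbitrary continuation \<open>k\<close>: the
  subcommand of a sequence or a loop runs with a longer stack, which again must be
  reachable.\<close>

lemma exec_steps:
  assumes "exec \<phi> a s s'" "a # k \<in> reach c" "wf_com m c"
  shows "\<exists>t. (step (machine_of c) \<phi> ^^ t) \<lparr>state = code c (a # k), cells = fst s, head = snd s\<rparr>
    = \<lparr>state = code c k, cells = fst s', head = snd s'\<rparr>"
proof -
  let ?M = "machine_of c"
  let ?c = "\<lambda>k s. \<lparr>state = code c k, cells = fst s, head = snd s\<rparr>"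
  have n: "num_tapes ?M = tapes c" by (simp add: machine_of_def)
  have len: "length (scanned ?M s) = tapes c" for s by (simp add: scanned_def n)
  have skip: "step ?M \<phi> \<lparr>state = code c l, cells = C, head = H\<rparr> = \<lparr>state = code c l', cells = C, head = H\<rparr>"
    if "l \<in> reach c"
      "act c l (scanned ?M \<lparr>state = code c l, cells = C, head = H\<rparr>)
        = Move (code c l') (map (\<lambda>a. (a, Stay)) (scanned ?M \<lparr>state = code c l, cells = C, head = H\<rparr>))"
    for l l' C H
    using that by (auto simp: step_def delta_machine_of len nth_scanned n fun_eq_iff)
  have join: "\<exists>t. (step ?M \<phi> ^^ t) x = z"
    if "(step ?M \<phi> ^^ t1) x = y" "\<exists>t. (step ?M \<phi> ^^ t) y = z" for x y z t1
    using that by (metis add.commute comp_apply funpow_add)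
  have join1: "\<exists>t. (step ?M \<phi> ^^ t) x = z"
    if "step ?M \<phi> x = y" "\<exists>t. (step ?M \<phi> ^^ t) y = z" for x y z
    using join[of 1] that by simp
  have done0: "\<exists>t. (step ?M \<phi> ^^ t) x = x" for x
    by (rule exI[of _ 0]) simp
  have "\<exists>t. (step ?M \<phi> ^^ t) (?c (a # k) s) = ?c k s'"
    using assms(1,2)
  proof (induction arbitrary: k)
    case (Act j w d C H)
    have "j < tapes c" using reach_ok[OF Act assms(3), of "Act j w d"] by auto
    then have "step ?M \<phi> (?c (Act j w d # k) (C, H))
        = ?c k (C(j := (C j)(H j := w)), H(j := H j + shift d))"
      using Act by (auto simp: step_def delta_machine_of len nth_scanned n fun_eq_iff nth_list_update)
    then show ?case using join1 done0 by blast
  next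
    case (Ask i C H)
    have "step ?M \<phi> (?c (Ask i # k) (C, H)) = ?c k
      (C(3 := word_tape (fraction_word (quotient_of (\<phi> i (LEAST k. C 2 (int k) \<noteq> stroke))))), H(3 := 0))"
      using Ask by (simp add: step_def delta_machine_of query_number_def)
    then show ?case using join1 done0 by blast
  next
    case (Seq a s s' b s'')
    have r: "a # b # k \<in> reach c" "b # k \<in> reach c"
      using reach_succs[OF Seq.prems] reach_tl[of a "b # k" c] by auto
    have "step ?M \<phi> (?c ((a ;; b) # k) s) = ?c (a # b # k) s"
      using skip[OF Seq.prems] by simp
    then show ?case
      using join1 join Seq.IH(1)[OF r(1)] Seq.IH(2)[OF r(2)] by metis
  next
    case (WhileF C j H x a)
    have "j < tapes c" using reach_ok[OF WhileF.prems assms(3), of "While j x a"] by auto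
    then have "step ?M \<phi> (?c (While j x a # k) (C, H)) = ?c k (C, H)"
      using skip[OF WhileF.prems, of C H] WhileF.hyps by (simp add: nth_scanned n)
    then show ?case using join1 done0 by blast
  next
    case (WhileT C j H x a s' s'')
    have j: "j < tapes c" using reach_ok[OF WhileT.prems assms(3), of "While j x a"] by auto
    have r: "a # While j x a # k \<in> reach c" using reach_succs[OF WhileT.prems] by auto
    have "step ?M \<phi> (?c (While j x a # k) (C, H)) = ?c (a # While j x a # k) (C, H)"
      using skip[OF WhileT.prems, of C H] WhileT.hyps j by (simp add: nth_scanned n)
    then show ?case
      using join1 join WhileT.IH(1)[OF r] WhileT.IH(2)[OF WhileT.prems] by metis
  qed
  then show ?thesis .
qed

lemma outputs_machine_of:
  assumes "exec \<phi> c (\<lambda>j. word_tape (if j = 0 then nat_word k else []), \<lambda>_. 0) (C, H)"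
    and "wf_com m c" and "\<forall>(a, b) \<in> set fs. b > 0"
    and "C 1 = word_tape (concat (map fraction_word fs))"
  shows "outputs (machine_of c) \<phi> k (map fraction_value fs)"
proof -
  have "[c] \<in> reach c" by (simp add: reach_def stacks_start)
  from exec_steps[OF assms(1) this assms(2)] obtain t where
    t: "(step (machine_of c) \<phi> ^^ t) (initial k) = \<lparr>state = code c [], cells = C, head = H\<rparr>"
    by (auto simp: initial_def code_start)
  have "halted (machine_of c) \<lparr>state = code c [], cells = C, head = H\<rparr>"
    by (simp add: halted_def delta_machine_of reach_def)
  then show ?thesis using assms(3,4) t unfolding outputs_def Let_def
    by (intro exI[of _ t] exI[of _ fs]) simp
qed

section \<open>Registers\<close>

text \<open>Register \<open>r\<close> lives on tape \<open>r + 4\<close>, as strokes to the left of the head.\<close>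

definition conf :: "(nat \<Rightarrow> nat) \<Rightarrow> mem \<Rightarrow> mem" where
  "conf \<rho> X = (\<lambda>j. if j < 4 then fst X j else word_tape (nat_word (\<rho> (j - 4))),
     \<lambda>j. if j < 4 then snd X j else int (\<rho> (j - 4)))"

lemma word_tape_snoc: "(word_tape w)(int (length w) := x) = word_tape (w @ [x])"
  by (auto simp: word_tape_def fun_eq_iff nth_append)

lemma word_tape_nat_word_upd:
  "(word_tape (nat_word n))(int n := stroke) = word_tape (nat_word (Suc n))"
  using word_tape_snoc[of "nat_word n" stroke] by (simp add: nat_word_def replicate_append_same)

lemma word_tape_nat_word_Suc:
  "word_tape (nat_word (Suc n)) z = (if z = int n then stroke else word_tape (nat_word n) z)"
  by (simp flip: word_tape_nat_word_upd)

lemma word_tape_nat_word_blank: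
  "(word_tape (nat_word n))(int n := blank) = word_tape (nat_word n)"
  "(word_tape (nat_word (Suc n)))(int n := blank) = word_tape (nat_word n)"
  by (auto simp: word_tape_def nat_word_def fun_eq_iff simp del: replicate_Suc)

lemma word_tape_nat_word_scan:
  "word_tape (nat_word (Suc n)) (int n) = stroke" "word_tape (nat_word n) (-1) = blank"
  by (auto simp: word_tape_def nat_word_def simp del: replicate_Suc)

definition inc :: "nat \<Rightarrow> com" where
  "inc r = Act (r + 4) stroke Right"

lemma exec_eq: "exec \<phi> c s s' \<Longrightarrow> s' = s'' \<Longrightarrow> exec \<phi> c s s''"
  by simp

lemma exec_inc: "exec \<phi> (inc r) (conf \<rho> X) (conf (\<rho>(r := Suc (\<rho> r))) X)"
  unfolding inc_def conf_def
  by (rule exec_eq[OF exec.Act]) (auto simp: fun_eq_iff word_tape_nat_word_Suc)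

text \<open>The head rests on the blank behind the strokes. One move to the left tests for zero,
  since cell -1 is blank. The body first erases the last stroke, which restores the resting position
  with the register decremented.\<close>

definition loop :: "nat \<Rightarrow> com \<Rightarrow> com" where
  "loop r c = Act (r + 4) blank Left ;;
     While (r + 4) stroke (Act (r + 4) blank Stay ;; c ;; Act (r + 4) blank Left) ;;
     Act (r + 4) blank Right"

text \<open>The sequences \<rho> and \<open>X\<close> give the situation after \<open>i\<close>
  rounds. The body finds \<open>r\<close> already lowered and has to leave it at that value.\<close>

lemma exec_loop:
  assumes "\<And>i. i < n \<Longrightarrow> exec \<phi> c (conf ((\<rho> i)(r := n - Suc i)) (X i)) (conf (\<rho> (Suc i)) (X (Suc i)))"
    and "\<And>i. i \<le> n \<Longrightarrow> \<rho> i r = n - i"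
  shows "exec \<phi> (loop r c) (conf (\<rho> 0) (X 0)) (conf (\<rho> n) (X n))"
proof -
  \<comment> \<open>The situation at each test of the loop: the head of \<open>r\<close> is on its
    last stroke, or at -1 if there is none.\<close>
  define lft where "lft = (\<lambda>\<rho> X. (fst (conf \<rho> X), (snd (conf \<rho> X))(r + 4 := int (\<rho> r) - 1)))"
  let ?body = "Act (r + 4) blank Stay ;; c ;; Act (r + 4) blank Left"
  have l: "exec \<phi> (Act (r + 4) blank Left) (conf \<rho> X) (lft \<rho> X)" for \<rho> X
    unfolding lft_def conf_def
    by (rule exec_eq[OF exec.Act]) (auto simp: fun_eq_iff word_tape_nat_word_blank)
  have d: "exec \<phi> (Act (r + 4) blank Stay) (lft \<rho> X) (conf (\<rho>(r := m)) X)"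
    if "\<rho> r = Suc m" for \<rho> X m
    using that unfolding lft_def conf_def fst_conv snd_conv
    by (intro exec_eq[OF exec.Act]) (auto simp: fun_eq_iff word_tape_nat_word_blank)
  have z: "exec \<phi> (Act (r + 4) blank Right) (lft \<rho> X) (conf \<rho> X)" if "\<rho> r = 0" for \<rho> X
    using that unfolding lft_def conf_def fst_conv snd_conv
    by (intro exec_eq[OF exec.Act]) (auto simp: fun_eq_iff word_tape_def nat_word_def)
  have scan: "fst (lft \<rho> X) (r + 4) (snd (lft \<rho> X) (r + 4)) = stroke \<longleftrightarrow> \<rho> r \<noteq> 0" for \<rho> X
    by (cases "\<rho> r") (auto simp: lft_def conf_def word_tape_nat_word_scan)
  have "exec \<phi> (While (r + 4) stroke ?body) (lft (\<rho> 0) (X 0)) (lft (\<rho> n) (X n))"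
    using assms
  proof (induction n arbitrary: \<rho> X)
    case 0
    then show ?case using scan[of "\<rho> 0" "X 0"] exec.WhileF
      by (metis diff_self_eq_0 le_refl prod.collapse)
  next
    case (Suc n)
    have "exec \<phi> c (conf ((\<rho> 0)(r := n)) (X 0)) (conf (\<rho> 1) (X 1))"
      using Suc.prems(1)[OF zero_less_Suc] by (simp only: diff_Suc_Suc diff_zero One_nat_def)
    then have "exec \<phi> ?body (lft (\<rho> 0) (X 0)) (lft (\<rho> 1) (X 1))"
      using Suc.prems(2)[of 0] by (auto intro: exec.Seq d l)
    moreover have "exec \<phi> (While (r + 4) stroke ?body) (lft (\<rho> 1) (X 1)) (lft (\<rho> (Suc n)) (X (Suc n)))"
      using Suc.IH[of "\<lambda>i. \<rho> (Suc i)" "\<lambda>i. X (Suc i)"] Suc.prems(1)[of "Suc _"] Suc.prems(2)[of "Suc _"]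
      by simp
    ultimately show ?case
      using scan[of "\<rho> 0" "X 0"] Suc.prems(2)[of 0] exec.WhileT
      by (metis Zero_not_Suc diff_zero le0 prod.collapse)
  qed
  then show ?thesis
    unfolding loop_def using assms(2)[of n] by (auto intro!: exec.Seq l z)
qed

text \<open>Writing a blank on the blank cell under a resting head serves as the empty
  command.\<close>

definition clear :: "nat \<Rightarrow> com" where
  "clear r = loop r (Act (r + 4) blank Stay)"

lemma exec_clear: "exec \<phi> (clear r) (conf \<rho> X) (conf (\<rho>(r := 0)) X)"
proof -
  have "exec \<phi> (Act (r + 4) blank Stay) (conf \<rho> X) (conf \<rho> X)" for \<rho> X
    unfolding conf_def fst_conv snd_conv
    by (rule exec_eq[OF exec.Act]) (auto simp: fun_eq_iff word_tape_nat_word_blank)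
  then show ?thesis
    using exec_loop[of "\<rho> r" \<phi> "Act (r + 4) blank Stay" "\<lambda>i. \<rho>(r := \<rho> r - i)" r "\<lambda>i. X"]
    by (simp add: clear_def)
qed

definition move :: "nat \<Rightarrow> nat \<Rightarrow> com" where
  "move r t = loop r (inc t)"

lemma exec_move:
  assumes "r \<noteq> t"
  shows "exec \<phi> (move r t) (conf \<rho> X) (conf (\<rho>(r := 0, t := \<rho> t + \<rho> r)) X)"
proof -
  have "exec \<phi> (loop r (inc t)) (conf (\<rho>(r := \<rho> r - 0, t := \<rho> t + 0)) X)
    (conf (\<rho>(r := \<rho> r - \<rho> r, t := \<rho> t + \<rho> r)) X)"
    using assms
    by (intro exec_loop[where \<rho> = "\<lambda>i. \<rho>(r := \<rho> r - i, t := \<rho> t + i)" and X = "\<lambda>i. X"] exec_eq[OF exec_inc])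
      (auto simp: fun_upd_twist)
  then show ?thesis by (simp add: move_def)
qed

text \<open>A loop consumes its register, so a second copy is made in the scratch register
  \<open>u\<close> and moved back.\<close>

definition copy :: "nat \<Rightarrow> nat \<Rightarrow> nat \<Rightarrow> com" where
  "copy r t u = loop r (inc t ;; inc u) ;; move u r"

lemma exec_copy:
  assumes "r \<noteq> t" "r \<noteq> u" "t \<noteq> u" "\<rho> u = 0"
  shows "exec \<phi> (copy r t u) (conf \<rho> X) (conf (\<rho>(t := \<rho> t + \<rho> r)) X)"
proof -
  have l: "exec \<phi> (loop r (inc t ;; inc u)) (conf (\<rho>(r := \<rho> r - 0, t := \<rho> t + 0, u := 0)) X)
    (conf (\<rho>(r := \<rho> r - \<rho> r, t := \<rho> t + \<rho> r, u := \<rho> r)) X)"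
    using assms
    by (intro exec_loop[where \<rho> = "\<lambda>i. \<rho>(r := \<rho> r - i, t := \<rho> t + i, u := i)" and X = "\<lambda>i. X"]
        exec.Seq[OF exec_inc exec_eq[OF exec_inc]])
      (auto simp: fun_eq_iff intro!: arg_cong2[of _ _ _ _ conf])
  have "\<rho>(r := \<rho> r - 0, t := \<rho> t + 0, u := 0) = \<rho>" using assms by auto
  then have "exec \<phi> (loop r (inc t ;; inc u)) (conf \<rho> X)
    (conf (\<rho>(r := \<rho> r - \<rho> r, t := \<rho> t + \<rho> r, u := \<rho> r)) X)"
    using l by (simp only:)
  then show ?thesis
    unfolding copy_def
    by (rule exec.Seq[OF _ exec_eq[OF exec_move]])
      (use assms in \<open>auto simp: fun_eq_iff intro!: arg_cong2[of _ _ _ _ conf]\<close>)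
qed

section \<open>Primitive recursion\<close>

definition push :: "nat \<Rightarrow> (nat \<Rightarrow> nat) \<Rightarrow> nat \<Rightarrow> nat" where
  "push x v i = (case i of 0 \<Rightarrow> x | Suc j \<Rightarrow> v j)"

lemma push_simps [simp]: "push x v 0 = x" "push x v (Suc i) = v i"
  by (simp_all add: push_def)

text \<open>The variables are de Bruijn indices: the step function of a recursion sees the counter as
  variable \<open>0\<close> and the previous value as variable \<open>1\<close>.\<close>

inductive pr :: "((nat \<Rightarrow> nat) \<Rightarrow> nat) \<Rightarrow> bool" where
  Var: "pr (\<lambda>v. v i)"
| Zero: "pr (\<lambda>v. 0)"
| Suc: "pr F \<Longrightarrow> pr (\<lambda>v. Suc (F v))"
| Rec: "pr F \<Longrightarrow> pr G \<Longrightarrow> pr B \<Longrightarrow> pr (\<lambda>v. rec_nat (F v) (\<lambda>i r. G (push i (push r v))) (B v))"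

text \<open>The map \<open>a\<close> places the variables in registers below \<open>N\<close>; it is
  arbitrary so that a recursion can put its counter and its value where it wants. Registers from
  \<open>N\<close> on are scratch space: zero before, and zero again afterwards except for the
  result in \<open>N\<close>.\<close>

definition compiled :: "((nat \<Rightarrow> nat) \<Rightarrow> nat) \<Rightarrow> bool" where
  "compiled F \<longleftrightarrow> (\<forall>a N. (\<forall>i. a i < N) \<longrightarrow> (\<exists>c. wf_com 0 c \<and>
     (\<forall>\<phi> \<rho> X. (\<forall>i\<ge>N. \<rho> i = 0) \<longrightarrow> exec \<phi> c (conf \<rho> X) (conf (\<rho>(N := F (\<lambda>i. \<rho> (a i)))) X))))"

lemma compiledD:
  assumes "compiled F" "\<And>i. a i < N"
  obtains c where "wf_com 0 c"
    "\<And>\<phi> \<rho> X. (\<And>i. i \<ge> N \<Longrightarrow> \<rho> i = 0) \<Longrightarrow> exec \<phi> c (conf \<rho> X) (conf (\<rho>(N := F (\<lambda>i. \<rho> (a i)))) X)"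
  using assms unfolding compiled_def by metis

lemma wf_register_ops [simp]:
  "wf_com m (inc r)" "wf_com m (loop r c) \<longleftrightarrow> wf_com m c" "wf_com m (clear r)"
  "wf_com m (move r t)" "wf_com m (copy r t u)"
  by (simp_all add: inc_def loop_def clear_def move_def copy_def)

lemma compiled_Rec:
  assumes "compiled F" "compiled G" "compiled B"
  shows "compiled (\<lambda>v. rec_nat (F v) (\<lambda>i r. G (push i (push r v))) (B v))"
  unfolding compiled_def
proof (intro allI impI)
  fix a :: "nat \<Rightarrow> nat" and N
  assume "\<forall>i. a i < N"
  then have a: "a i < N" for i by simp
  then have a1: "a i < Suc N" for i by (simp add: less_SucI)
  have a3: "push (N + 2) (push (N + 1) a) i < N + 3" for i
    using a[of "i - 2"] by (auto simp: push_def split: nat.split)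
  obtain cB where cB: "wf_com 0 cB"
    "\<And>\<phi> \<rho> X. (\<And>i. i \<ge> N \<Longrightarrow> \<rho> i = 0) \<Longrightarrow> exec \<phi> cB (conf \<rho> X) (conf (\<rho>(N := B (\<lambda>i. \<rho> (a i)))) X)"
    using compiledD[OF assms(3), of a N] a by blast
  obtain cF where cF: "wf_com 0 cF"
    "\<And>\<phi> \<rho> X. (\<And>i. i \<ge> Suc N \<Longrightarrow> \<rho> i = 0) \<Longrightarrow> exec \<phi> cF (conf \<rho> X) (conf (\<rho>(Suc N := F (\<lambda>i. \<rho> (a i)))) X)"
    using compiledD[OF assms(1), of a "Suc N"] a1 by blast
  obtain cG where cG: "wf_com 0 cG"
    "\<And>\<phi> \<rho> X. (\<And>i. i \<ge> N + 3 \<Longrightarrow> \<rho> i = 0) \<Longrightarrow> exec \<phi> cG (conf \<rho> X)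
       (conf (\<rho>(N + 3 := G (\<lambda>i. \<rho> (push (N + 2) (push (N + 1) a) i)))) X)"
    using compiledD[OF assms(2), of "push (N + 2) (push (N + 1) a)" "N + 3"] a3 by blast
  \<comment> \<open>Register \<open>N\<close> counts down from the bound, \<open>N + 1\<close> holds
    the current value, \<open>N + 2\<close> counts up, and \<open>N + 3\<close> receives the next
    value.\<close>
  define c where "c = cB ;; cF ;; loop N (cG ;; clear (N + 1) ;; move (N + 3) (N + 1) ;; inc (N + 2)) ;;
    clear (N + 2) ;; move (N + 1) N"
  have "exec \<phi> c (conf \<rho> X) (conf (\<rho>(N := rec_nat (F (\<lambda>i. \<rho> (a i)))
      (\<lambda>i r. G (push i (push r (\<lambda>i. \<rho> (a i))))) (B (\<lambda>i. \<rho> (a i))))) X)"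
    if \<rho>: "\<forall>i\<ge>N. \<rho> i = 0" for \<phi> \<rho> X
  proof -
    define v where "v = (\<lambda>i. \<rho> (a i))"
    define R where "R = rec_nat (F v) (\<lambda>i r. G (push i (push r v)))"
    have R: "R 0 = F v" "R (Suc i) = G (push i (push (R i) v))" for i
      by (simp_all add: R_def)
    define n where "n = B v"
    define \<sigma> where "\<sigma> i = \<rho>(N := n - i, N + 1 := R i, N + 2 := i)" for i
    have 1: "exec \<phi> cB (conf \<rho> X) (conf (\<rho>(N := n)) X)"
      using cB(2)[of \<rho> \<phi> X] \<rho> by (simp add: n_def v_def)
    have "a i \<noteq> N" for i using a[of i] by simp
    then have "(\<lambda>i. (\<rho>(N := n)) (a i)) = v" by (simp add: v_def)
    then have 2: "exec \<phi> cF (conf (\<rho>(N := n)) X) (conf (\<sigma> 0) X)"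
      using \<rho> by (intro exec_eq[OF cF(2)])
        (auto simp: \<sigma>_def R(1) fun_eq_iff intro!: arg_cong2[of _ _ _ _ conf])
    have "exec \<phi> (loop N (cG ;; clear (N + 1) ;; move (N + 3) (N + 1) ;; inc (N + 2)))
      (conf (\<sigma> 0) X) (conf (\<sigma> n) X)"
    proof (rule exec_loop[where X = "\<lambda>i. X"])
      fix i assume "i < n"
      let ?\<sigma> = "(\<sigma> i)(N := n - Suc i)"
      have v: "(\<lambda>j. ?\<sigma> (push (N + 2) (push (N + 1) a) j)) = push i (push (R i) v)"
      proof
        fix j
        show "?\<sigma> (push (N + 2) (push (N + 1) a) j) = push i (push (R i) v) j"
          using a[of "j - 2"] by (auto simp: push_def \<sigma>_def v_def split: nat.split)
      qed
      have "exec \<phi> cG (conf ?\<sigma> X) (conf (?\<sigma>(N + 3 := R (Suc i))) X)"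
        unfolding R(2) v[symmetric] by (rule cG(2)) (use \<rho> in \<open>auto simp: \<sigma>_def\<close>)
      then show "exec \<phi> (cG ;; clear (N + 1) ;; move (N + 3) (N + 1) ;; inc (N + 2)) (conf ?\<sigma> X) (conf (\<sigma> (Suc i)) X)"
        by (rule exec.Seq[OF _ exec.Seq[OF exec_clear exec.Seq[OF exec_move exec_eq[OF exec_inc]]]])
          (use \<rho> in \<open>auto simp: \<sigma>_def fun_eq_iff intro!: arg_cong2[of _ _ _ _ conf]\<close>)
    qed (simp add: \<sigma>_def)
    then show ?thesis
      unfolding c_def v_def[symmetric] R_def[symmetric] n_def[symmetric]
      by (intro exec.Seq[OF 1] exec.Seq[OF 2] exec.Seq[OF _ exec.Seq[OF exec_clear exec_eq[OF exec_move]]])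
        (use \<rho> in \<open>auto simp: \<sigma>_def fun_eq_iff intro!: arg_cong2[of _ _ _ _ conf]\<close>)
  qed
  moreover have "wf_com 0 c"
    using cB(1) cF(1) cG(1) by (simp add: c_def)
  ultimately show "\<exists>c. wf_com 0 c \<and> (\<forall>\<phi> \<rho> X. (\<forall>i\<ge>N. \<rho> i = 0) \<longrightarrow> exec \<phi> c (conf \<rho> X)
    (conf (\<rho>(N := rec_nat (F (\<lambda>i. \<rho> (a i))) (\<lambda>i r. G (push i (push r (\<lambda>i. \<rho> (a i))))) (B (\<lambda>i. \<rho> (a i))))) X))"
    by blast
qed

lemma pr_compiled: "pr F \<Longrightarrow> compiled F"
proof (induction rule: pr.induct)
  case (Var i)
  have "exec \<phi> (copy (a i) N (Suc N)) (conf \<rho> X) (conf (\<rho>(N := \<rho> (a i))) X)"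
    if "\<forall>i. a i < N" "\<forall>i\<ge>N. \<rho> i = 0" for a N \<phi> X and \<rho> :: "nat \<Rightarrow> nat"
    using that(1)[rule_format, of i] that(2) by (intro exec_eq[OF exec_copy]) auto
  then show ?case unfolding compiled_def using wf_register_ops(5) by blast
next
  case Zero
  have "exec \<phi> (clear N) (conf \<rho> X) (conf (\<rho>(N := 0)) X)" for N \<phi> \<rho> X
    by (rule exec_clear)
  then show ?case unfolding compiled_def using wf_register_ops(3) by blast
next
  case (Suc F)
  show ?case unfolding compiled_def
  proof (intro allI impI)
    fix a :: "nat \<Rightarrow> nat" and N
    assume "\<forall>i. a i < N"
    then obtain c where c: "wf_com 0 c"
      "\<And>\<phi> \<rho> X. (\<And>i. i \<ge> N \<Longrightarrow> \<rho> i = 0) \<Longrightarrow> exec \<phi> c (conf \<rho> X) (conf (\<rho>(N := F (\<lambda>i. \<rho> (a i)))) X)"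
      using compiledD[OF Suc.IH, of a N] by blast
    have "exec \<phi> (c ;; inc N) (conf \<rho> X) (conf (\<rho>(N := Suc (F (\<lambda>i. \<rho> (a i))))) X)"
      if "\<forall>i\<ge>N. \<rho> i = 0" for \<phi> \<rho> X
      by (rule exec.Seq[OF c(2) exec_eq[OF exec_inc]]) (use that in auto)
    moreover have "wf_com 0 (c ;; inc N)" using c(1) by simp
    ultimately show "\<exists>c. wf_com 0 c \<and> (\<forall>\<phi> \<rho> X. (\<forall>i\<ge>N. \<rho> i = 0) \<longrightarrow>
      exec \<phi> c (conf \<rho> X) (conf (\<rho>(N := Suc (F (\<lambda>i. \<rho> (a i))))) X))"
      by blast
  qed
next
  case (Rec F G B)
  then show ?case by (intro compiled_Rec)
qed

text \<open>Comes before substitution, because substituting under a recursion shifts the substituted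
  functions by two variables. The renaming used for the step function fixes 0 and 1 and acts as
  \<open>s\<close> beyond them.\<close>

lemma pr_rename: "pr F \<Longrightarrow> pr (\<lambda>v. F (\<lambda>i. v (s i)))"
proof (induction arbitrary: s rule: pr.induct)
  case (Rec F G B)
  have "(\<lambda>i. push x (push y v) (push 0 (\<lambda>j. Suc (push 0 (\<lambda>j. Suc (s j)) j)) i)) = push x (push y (\<lambda>i. v (s i)))" for x y v
    by (auto simp: push_def fun_eq_iff split: nat.split)
  then show ?case
    using pr.Rec[OF Rec.IH(1)[of s] Rec.IH(2)[of "push 0 (\<lambda>j. Suc (push 0 (\<lambda>j. Suc (s j)) j))"] Rec.IH(3)[of s]]
    by simp
qed (auto intro: pr.intros)

lemma pr_subst: "pr F \<Longrightarrow> (\<And>i. pr (S i)) \<Longrightarrow> pr (\<lambda>v. F (\<lambda>i. S i v))"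
proof (induction arbitrary: S rule: pr.induct)
  case (Rec F G B)
  define S' where "S' = (\<lambda>i. case i of 0 \<Rightarrow> (\<lambda>w. w 0) | Suc j \<Rightarrow> (case j of 0 \<Rightarrow> (\<lambda>w. w 1)
    | Suc j \<Rightarrow> (\<lambda>w. S j (\<lambda>i. w (i + 2)))))"
  have "pr (S' i)" for i
    using pr_rename[OF Rec.prems] by (auto simp: S'_def intro: pr.intros split: nat.split)
  moreover have "(\<lambda>i. S' i (push x (push y v))) = push x (push y (\<lambda>i. S i v))" for x y v
    by (auto simp: S'_def push_def fun_eq_iff split: nat.split)
  ultimately show ?case
    using pr.Rec[OF Rec.IH(1)[OF Rec.prems] Rec.IH(2)[of S'] Rec.IH(3)[OF Rec.prems]] by simp
qed (auto intro: pr.intros)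

lemma pr_const: "pr (\<lambda>v. c)"
  by (induction c) (auto intro: pr.intros)

text \<open>Reduces closure under an operation to its instance at plain variables, where the
  operation is defined once by recursion.\<close>

lemma pr_app1: "pr (\<lambda>v. f (v 0)) \<Longrightarrow> pr A \<Longrightarrow> pr (\<lambda>v. f (A v))"
  using pr_subst[of "\<lambda>v. f (v 0)" "\<lambda>i. A"] by simp

lemma pr_app2: "pr (\<lambda>v. f (v 0) (v 1)) \<Longrightarrow> pr A \<Longrightarrow> pr B \<Longrightarrow> pr (\<lambda>v. f (A v) (B v))"
  using pr_subst[of "\<lambda>v. f (v 0) (v 1)" "\<lambda>i. if i = 0 then A else B"] by simp

lemma pr_app3:
  "pr (\<lambda>v. f (v 0) (v 1) (v 2)) \<Longrightarrow> pr A \<Longrightarrow> pr B \<Longrightarrow> pr C \<Longrightarrow> pr (\<lambda>v. f (A v) (B v) (C v))"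
  using pr_subst[of "\<lambda>v. f (v 0) (v 1) (v 2)" "\<lambda>i. if i = 0 then A else if i = 1 then B else C"] by simp

lemma pr_rec:
  assumes "pr F" "pr (\<lambda>w. G (w 0) (w 1) (\<lambda>j. w (j + 2)))" "pr B"
  shows "pr (\<lambda>v. rec_nat (F v) (\<lambda>i r. G i r v) (B v))"
  using pr.Rec[OF assms] by (simp add: numeral_2_eq_2)

lemma pr_app4:
  assumes "pr (\<lambda>v. f (v 0) (v 1) (v 2) (v 3))" "pr A" "pr B" "pr C" "pr D"
  shows "pr (\<lambda>v. f (A v) (B v) (C v) (D v))"
  using pr_subst[OF assms(1), of "\<lambda>i. if i = 0 then A else if i = 1 then B else if i = 2 then C else D"] assms(2-)
  by simp

section \<open>Primitive recursive arithmetic and decidable predicates\<close>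

lemma pr_add: "pr A \<Longrightarrow> pr B \<Longrightarrow> pr (\<lambda>v. A v + B v)"
proof (erule (1) pr_app2[rotated])
  have "rec_nat a (\<lambda>i r. Suc r) b = a + b" for a b :: nat
    by (induction b) auto
  moreover have "pr (\<lambda>v. rec_nat (v 0) (\<lambda>i r. Suc r) (v 1))"
    by (intro pr_rec pr.intros)
  ultimately show "pr (\<lambda>v. v 0 + v 1)" by simp
qed

lemma pr_mult: "pr A \<Longrightarrow> pr B \<Longrightarrow> pr (\<lambda>v. A v * B v)"
proof (erule (1) pr_app2[rotated])
  have "rec_nat 0 (\<lambda>i r. r + a) b = a * b" for a b :: nat
    by (induction b) auto
  moreover have "pr (\<lambda>v. rec_nat 0 (\<lambda>i r. r + v 0) (v 1))"
    by (intro pr_rec pr_add pr.intros)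
  ultimately show "pr (\<lambda>v. v 0 * v 1)" by simp
qed

lemma pr_diff: "pr A \<Longrightarrow> pr B \<Longrightarrow> pr (\<lambda>v. A v - B v)"
proof (erule (1) pr_app2[rotated])
  have "rec_nat 0 (\<lambda>i r. i) a = a - 1" for a :: nat
    by (induction a) auto
  moreover have "pr (\<lambda>v. rec_nat 0 (\<lambda>i r. i) (v 0))"
    by (intro pr_rec pr.intros)
  ultimately have "pr (\<lambda>v. v 0 - 1)" by simp
  note pr_pred = pr_app1[OF this]
  have "rec_nat a (\<lambda>i r. r - 1) b = a - b" for a b :: nat
    by (induction b) auto
  moreover have "pr (\<lambda>v. rec_nat (v 0) (\<lambda>i r. r - 1) (v 1))"
    by (intro pr_rec pr_pred pr.intros)
  ultimately show "pr (\<lambda>v. v 0 - v 1)" by simp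
qed

lemma pr_power: "pr A \<Longrightarrow> pr B \<Longrightarrow> pr (\<lambda>v. A v ^ B v)"
proof (erule (1) pr_app2[rotated])
  have "rec_nat 1 (\<lambda>i r. r * a) b = a ^ b" for a b :: nat
    by (induction b) auto
  moreover have "pr (\<lambda>v. rec_nat 1 (\<lambda>i r. r * v 0) (v 1))"
    by (intro pr_rec pr_mult pr.Var pr_const)
  ultimately show "pr (\<lambda>v. v 0 ^ v 1)" by simp
qed

definition prb :: "((nat \<Rightarrow> nat) \<Rightarrow> bool) \<Rightarrow> bool" where
  "prb P \<longleftrightarrow> pr (\<lambda>v. of_bool (P v))"

lemma pr_of_bool: "prb P \<Longrightarrow> pr (\<lambda>v. of_bool (P v))"
  by (simp add: prb_def)

lemma prb_le: "pr A \<Longrightarrow> pr B \<Longrightarrow> prb (\<lambda>v. A v \<le> B v)"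
proof -
  have "of_bool (a \<le> b) = 1 - (a - b)" for a b :: nat by auto
  then show "pr A \<Longrightarrow> pr B \<Longrightarrow> prb (\<lambda>v. A v \<le> B v)"
    by (simp only: prb_def) (intro pr_diff pr_const)
qed

lemma prb_not: "prb P \<Longrightarrow> prb (\<lambda>v. \<not> P v)"
proof -
  have "of_bool (\<not> b) = (1 - of_bool b :: nat)" for b by auto
  then show "prb P \<Longrightarrow> prb (\<lambda>v. \<not> P v)"
    by (simp only: prb_def) (intro pr_diff pr_const)
qed

lemma prb_conj: "prb P \<Longrightarrow> prb Q \<Longrightarrow> prb (\<lambda>v. P v \<and> Q v)"
  by (simp only: prb_def of_bool_conj) (intro pr_mult)

lemma prb_disj: "prb P \<Longrightarrow> prb Q \<Longrightarrow> prb (\<lambda>v. P v \<or> Q v)"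
  using prb_not[OF prb_conj[OF prb_not prb_not], of P Q] by simp

lemma prb_less: "pr A \<Longrightarrow> pr B \<Longrightarrow> prb (\<lambda>v. A v < B v)"
  using prb_not[OF prb_le, of B A] by (simp add: not_le)

lemma prb_eq: "pr A \<Longrightarrow> pr B \<Longrightarrow> prb (\<lambda>v. A v = B v)"
  using prb_conj[OF prb_le prb_le, of A B B A] by (simp add: eq_iff)

lemma pr_if: "prb P \<Longrightarrow> pr A \<Longrightarrow> pr B \<Longrightarrow> pr (\<lambda>v. if P v then A v else B v)"
proof -
  assume "prb P" "pr A" "pr B"
  then have "pr (\<lambda>v. A v * of_bool (P v) + B v * (1 - of_bool (P v)))"
    by (intro pr_add pr_mult pr_diff pr_const pr_of_bool)
  moreover have "(\<lambda>v. A v * of_bool (P v) + B v * (1 - of_bool (P v))) = (\<lambda>v. if P v then A v else B v)"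
    by auto
  ultimately show ?thesis by simp
qed

lemmas pr_arith = pr_if pr_of_bool prb_not prb_conj prb_disj prb_less prb_le prb_eq
  pr_add pr_mult pr_diff pr_power pr.Suc pr.Var pr_const

lemma pr_mod_2: "pr A \<Longrightarrow> pr (\<lambda>v. A v mod 2)"
proof (erule pr_app1[rotated])
  have "rec_nat 0 (\<lambda>i r. 1 - r) a = a mod 2" for a :: nat
    by (induction a) (auto simp: mod_Suc)
  moreover have "pr (\<lambda>v. rec_nat 0 (\<lambda>i r. 1 - r) (v 0))"
    by (intro pr_rec pr_arith)
  ultimately show "pr (\<lambda>v. v 0 mod 2)" by simp
qed

lemma pr_triangle: "pr A \<Longrightarrow> pr (\<lambda>v. triangle (A v))"
proof (erule pr_app1[rotated])
  have "rec_nat 0 (\<lambda>i r. r + Suc i) a = triangle a" for a :: nat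
    by (induction a) auto
  moreover have "pr (\<lambda>v. rec_nat 0 (\<lambda>i r. r + Suc i) (v 0))"
    by (intro pr_rec pr_arith)
  ultimately show "pr (\<lambda>v. triangle (v 0))" by simp
qed

section \<open>Pairing and streams of numbers\<close>

definition pair :: "nat \<Rightarrow> nat \<Rightarrow> nat" where "pair a b = prod_encode (a, b)"
definition pfst :: "nat \<Rightarrow> nat" where "pfst a = fst (prod_decode a)"
definition psnd :: "nat \<Rightarrow> nat" where "psnd a = snd (prod_decode a)"

lemma pair_simps [simp]: "pfst (pair a b) = a" "psnd (pair a b) = b" "pair (pfst c) (psnd c) = c"
  by (simp_all add: pair_def pfst_def psnd_def)

lemma pair_0 [simp]: "pfst 0 = 0" "psnd 0 = 0" "pair 0 0 = 0"
  by (simp_all add: pair_def pfst_def psnd_def prod_encode_def prod_decode_def prod_decode_aux.simps)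

lemma pr_pair: "pr A \<Longrightarrow> pr B \<Longrightarrow> pr (\<lambda>v. pair (A v) (B v))"
  by (simp only: pair_def prod_encode_def split_conv) (intro pr_triangle pr_arith)

text \<open>The largest \<open>r\<close> with \<open>triangle r \<le> n\<close>. For the code of a
  pair this is the sum of the components, which makes unpairing primitive recursive.\<close>

definition triangle_root :: "nat \<Rightarrow> nat" where
  "triangle_root = rec_nat 0 (\<lambda>i r. if triangle (Suc r) \<le> Suc i then Suc r else r)"

lemma triangle_mono: "a \<le> b \<Longrightarrow> triangle a \<le> triangle b"
  by (induction rule: dec_induct) auto

lemma triangle_root_bounds: "triangle (triangle_root n) \<le> n \<and> n < triangle (Suc (triangle_root n))"
  by (induction n) (auto simp: triangle_root_def)

lemma triangle_root_prod_encode: "triangle_root (prod_encode (a, b)) = a + b"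
proof -
  let ?n = "prod_encode (a, b)" and ?s = "triangle_root (prod_encode (a, b))"
  have n: "triangle (a + b) \<le> ?n" "?n < triangle (Suc (a + b))"
    by (auto simp: prod_encode_def)
  have "\<not> Suc (a + b) \<le> ?s" "\<not> Suc ?s \<le> a + b"
    using triangle_root_bounds[of ?n] n triangle_mono[of "Suc (a + b)" ?s] triangle_mono[of "Suc ?s" "a + b"]
    by linarith+
  then show ?thesis by simp
qed

lemma pfst_psnd_eq: "pfst n = n - triangle (triangle_root n)" "psnd n = triangle_root n - pfst n"
proof -
  obtain a b where "n = prod_encode (a, b)" by (metis prod_decode_inverse surj_pair)
  then show "pfst n = n - triangle (triangle_root n)" "psnd n = triangle_root n - pfst n"
    using triangle_root_prod_encode[of a b]
    by (simp_all add: pfst_def psnd_def) (simp add: prod_encode_def)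
qed

lemma pr_triangle_root: "pr A \<Longrightarrow> pr (\<lambda>v. triangle_root (A v))"
  by (erule pr_app1[rotated]) (unfold triangle_root_def, intro pr_rec pr_triangle pr_arith)

lemma pr_pfst: "pr A \<Longrightarrow> pr (\<lambda>v. pfst (A v))"
  by (simp only: pfst_psnd_eq) (intro pr_triangle pr_triangle_root pr_arith)

lemma pr_psnd: "pr A \<Longrightarrow> pr (\<lambda>v. psnd (A v))"
  by (simp only: pfst_psnd_eq(2)) (intro pr_pfst pr_triangle_root pr_arith)

text \<open>Numbers as streams of numbers of which all but finitely many are zero.\<close>

definition drops :: "nat \<Rightarrow> nat \<Rightarrow> nat" where
  "drops s i = rec_nat s (\<lambda>_ r. psnd r) i"

definition get :: "nat \<Rightarrow> nat \<Rightarrow> nat" where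
  "get s i = pfst (drops s i)"

text \<open>Puts \<open>x\<close> in front of the tail behind position \<open>i\<close> and then
  prepends the old entries \<open>i - 1\<close> down to 0.\<close>

definition upd :: "nat \<Rightarrow> nat \<Rightarrow> nat \<Rightarrow> nat" where
  "upd s i x = rec_nat (pair x (psnd (drops s i))) (\<lambda>m r. pair (get s (i - Suc m)) r) i"

lemma pr_get: "pr A \<Longrightarrow> pr B \<Longrightarrow> pr (\<lambda>v. get (A v) (B v))"
  by (erule (1) pr_app2[rotated]) (unfold get_def drops_def, intro pr_pfst pr_psnd pr_rec pr_arith)

lemma pr_drops: "pr A \<Longrightarrow> pr B \<Longrightarrow> pr (\<lambda>v. drops (A v) (B v))"
  by (erule (1) pr_app2[rotated]) (unfold drops_def, intro pr_psnd pr_rec pr_arith)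

lemma pr_upd: "pr A \<Longrightarrow> pr B \<Longrightarrow> pr C \<Longrightarrow> pr (\<lambda>v. upd (A v) (B v) (C v))"
  by (erule (2) pr_app3[rotated])
    (unfold upd_def, intro pr_pair pr_psnd pr_drops pr_rec pr_get pr_arith)

lemma drops_0 [simp]: "drops 0 i = 0"
  by (induction i) (auto simp: drops_def)

lemma drops_Suc: "drops s (Suc i) = drops (psnd s) i"
  by (induction i) (auto simp: drops_def)

lemma get_0 [simp]: "get 0 i = 0"
  by (simp add: get_def)

lemma get_pair [simp]: "get (pair a s) 0 = a" "get (pair a s) (Suc i) = get s i"
  by (simp_all add: get_def drops_Suc) (simp add: drops_def)

lemma get_psnd_drops: "get (psnd (drops s i)) j = get s (Suc (i + j))"
proof -
  have "drops (drops s i) j = drops s (i + j)" for i j s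
    by (induction j) (auto simp: drops_def)
  moreover have "psnd (drops s i) = drops s (Suc i)" by (simp add: drops_def)
  ultimately show ?thesis by (simp add: get_def)
qed

lemma get_upd: "get (upd s i x) j = (if j = i then x else get s j)"
proof -
  let ?U = "rec_nat (pair x (psnd (drops s i))) (\<lambda>m r. pair (get s (i - Suc m)) r)"
  \<comment> \<open>After \<open>m\<close> rounds the stream starts at position \<open>i - m\<close>
    of the original.\<close>
  have "m \<le> i \<Longrightarrow> get (?U m) j = (if j = m then x else get s (i - m + j))" for m j
  proof (induction m arbitrary: j)
    case 0
    then show ?case by (cases j) (auto simp: get_psnd_drops)
  next
    case (Suc m)
    then show ?case by (cases j) (auto simp: Suc_diff_Suc)
  qed
  from this[of i j] show ?thesis by (simp add: upd_def)
qed

lemma ex_stream: "finite A \<Longrightarrow> \<exists>s. \<forall>i\<in>A. get s i = g i"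
proof (induction A rule: finite_induct)
  case (insert a A)
  then obtain s where "\<forall>i\<in>A. get s i = g i" by blast
  then show ?case by (intro exI[of _ "upd s a (g a)"]) (auto simp: get_upd)
qed simp

lemmas pr_intros = pr_rec pr_get pr_upd pr_pair pr_pfst pr_psnd pr_mod_2 pr_arith

section \<open>A universal machine\<close>

text \<open>Cell \<open>z\<close> of a tape is entry \<open>int_encode z\<close> of a stream.\<close>

fun direction_code :: "direction \<Rightarrow> nat" where
  "direction_code Left = 0"
| "direction_code Stay = 1"
| "direction_code Right = 2"

text \<open>\<open>int_encode\<close> sends cells from 0 on to even and negative cells to odd
  entries. A move therefore changes the entry by 2, up or down according to parity, except for the
  crossing between entries 0 and 1, which are cells 0 and -1.\<close>

definition shift_code :: "nat \<Rightarrow> nat \<Rightarrow> nat" where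
  "shift_code d c =
    (if d = 1 then c
     else if d = 0 then (if c mod 2 = 1 then c + 2 else if c = 0 then 1 else c - 2)
     else (if c mod 2 = 0 then c + 2 else if c = 1 then 0 else c - 2))"

lemma int_encode_eqs: "int_encode (int n) = 2 * n" "z < 0 \<Longrightarrow> int_encode z = Suc (2 * nat (- z - 1))"
  by (simp_all add: int_encode_def sum_encode_def)

lemma shift_code: "shift_code (direction_code d) (int_encode z) = int_encode (z + shift d)"
proof (cases z rule: int_cases)
  case (nonneg n)
  then show ?thesis
    by (cases n; cases d)
      (auto simp: shift_code_def int_encode_def sum_encode_def nat_add_distrib mod_Suc)
next
  case (neg n)
  then show ?thesis
    by (cases n; cases d)
      (auto simp: shift_code_def int_encode_def sum_encode_def nat_add_distrib mod_Suc)
qed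

lemma pr_shift_code: "pr A \<Longrightarrow> pr B \<Longrightarrow> pr (\<lambda>v. shift_code (A v) (B v))"
  by (erule (1) pr_app2[rotated]) (unfold shift_code_def, intro pr_intros)

text \<open>The word of the fraction \<open>n / 1\<close>; cell \<open>p\<close> is entry
  \<open>2 * p\<close>. Integers suffice, as the coordinates of the points in question are natural
  numbers.\<close>

definition answer :: "nat \<Rightarrow> nat" where
  "answer n = upd (upd (upd (rec_nat 0 (\<lambda>i r. upd r (2 * i) stroke) n) (2 * n) slash)
     (2 * n + 2) stroke) (2 * n + 4) end_mark"

lemma pr_answer: "pr A \<Longrightarrow> pr (\<lambda>v. answer (A v))"
  by (erule pr_app1[rotated]) (unfold answer_def, intro pr_intros)

lemma word_tape_fraction_word:
  "word_tape (fraction_word (int k, int l)) (int p) = (if p < k then stroke else if p = k then slash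
    else if p < k + 1 + l then stroke else if p = k + 1 + l then end_mark else blank)"
proof -
  have "fraction_word (int k, int l) = replicate k stroke @ slash # replicate l stroke @ [end_mark]"
    by (simp add: nat_word_def)
  moreover have "word_tape w (int p) = (if p < length w then w ! p else blank)" for w
    by (simp add: word_tape_def)
  ultimately show ?thesis
    by (auto simp: nth_append nth_Cons' simp del: fraction_word.simps)
qed

lemma get_answer: "get (answer n) (int_encode z) = word_tape (fraction_word (int n, 1)) z"
proof -
  have s: "get (rec_nat 0 (\<lambda>i r. upd r (2 * i) (Suc 0)) n) k = (if even k \<and> k < 2 * n then 1 else 0)" for n k
    by (induction n) (auto simp: get_upd elim!: evenE)
  show ?thesis
  proof (cases "z < 0")
    case True
    define m where "m = Suc (2 * nat (- z - 1))"
    have "odd m" by (simp add: m_def)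
    then show ?thesis
      using True by (auto simp: answer_def get_upd int_encode_eqs(2) s word_tape_def simp flip: m_def)
  next
    case False
    then obtain k where "z = int k" by (metis nonneg_int_cases not_less)
    then show ?thesis
      using word_tape_fraction_word[of n 1 k]
      by (simp add: answer_def get_upd int_encode_eqs s del: fraction_word.simps)
  qed
qed

definition scan_code :: "nat \<Rightarrow> nat \<Rightarrow> nat \<Rightarrow> nat" where
  "scan_code H C n = rec_nat 0 (\<lambda>j r. Suc (pair (get (get C j) (get H j)) r)) n"

text \<open>The recursion adds each tape at the front, hence the \<open>rev\<close> here and in
  \<open>codes\<close>; \<open>Suc (pair a r)\<close> is the list code of a cons.\<close>

lemma scan_code: "scan_code H C n = list_encode (rev (map (\<lambda>j. get (get C j) (get H j)) [0..<n]))"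
  by (induction n) (auto simp: scan_code_def pair_def)

lemma pr_scan_code: "pr A \<Longrightarrow> pr B \<Longrightarrow> pr D \<Longrightarrow> pr (\<lambda>v. scan_code (A v) (B v) (D v))"
  by (erule (2) pr_app3[rotated]) (unfold scan_code_def, intro pr_intros)

definition write_code :: "nat \<Rightarrow> nat \<Rightarrow> nat \<Rightarrow> nat \<Rightarrow> nat" where
  "write_code H C W n = rec_nat C (\<lambda>j r. upd r j (upd (get r j) (get H j) (pfst (get W j)))) n"

lemma get_write_code:
  "get (write_code H C W n) j = (if j < n then upd (get C j) (get H j) (pfst (get W j)) else get C j)"
  by (induction n) (auto simp: write_code_def get_upd)

lemma pr_write_code:
  "pr A \<Longrightarrow> pr B \<Longrightarrow> pr D \<Longrightarrow> pr E \<Longrightarrow> pr (\<lambda>v. write_code (A v) (B v) (D v) (E v))"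
  by (erule (3) pr_app4[rotated]) (unfold write_code_def, intro pr_intros)

definition move_code :: "nat \<Rightarrow> nat \<Rightarrow> nat \<Rightarrow> nat" where
  "move_code H W n = rec_nat H (\<lambda>j r. upd r j (shift_code (psnd (get W j)) (get r j))) n"

lemma get_move_code:
  "get (move_code H W n) j = (if j < n then shift_code (psnd (get W j)) (get H j) else get H j)"
  by (induction n) (auto simp: move_code_def get_upd)

lemma pr_move_code: "pr A \<Longrightarrow> pr B \<Longrightarrow> pr D \<Longrightarrow> pr (\<lambda>v. move_code (A v) (B v) (D v))"
  by (erule (2) pr_app3[rotated]) (unfold move_code_def, intro pr_shift_code pr_intros)

text \<open>
  The code of a machine consists of its number of tapes and a stream for its transition table; the
  code of a configuration consists of the state, the heads and the tapes. The machine with code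
  \<open>e\<close> is run with oracles for the point \<open>location e\<close>.
\<close>

definition location :: "nat \<Rightarrow> nat \<Rightarrow> nat" where
  "location e i = (if i = 0 then 2 ^ (e + 2) else 2)"

text \<open>The first component is a tag: 0 for halting (as \<open>pfst 0 = 0\<close>), 1 for a
  query, 2 for a move.\<close>

fun action_code :: "action \<Rightarrow> nat" where
  "action_code Halt = 0"
| "action_code (Query i q) = pair 1 (pair i q)"
| "action_code (Move q ws) =
    pair 2 (pair q (foldr (\<lambda>(w, d) r. pair (pair w (direction_code d)) r) ws 0))"

lemma get_foldr_pair: "j < length ws \<Longrightarrow> get (foldr (\<lambda>(w, d) r. pair (pair w (direction_code d)) r) ws 0) j
    = pair (fst (ws ! j)) (direction_code (snd (ws ! j)))"
proof (induction ws arbitrary: j)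
  case (Cons x ws)
  then show ?case by (cases j) (auto simp: case_prod_beta)
qed simp

definition action_at :: "nat \<Rightarrow> nat \<Rightarrow> nat" where
  "action_at e C = get (psnd e) (pair (pfst C) (scan_code (pfst (psnd C)) (psnd (psnd C)) (pfst e)))"

lemma pr_action_at: "pr A \<Longrightarrow> pr B \<Longrightarrow> pr (\<lambda>v. action_at (A v) (B v))"
  by (erule (1) pr_app2[rotated]) (unfold action_at_def, intro pr_scan_code pr_intros)

text \<open>The oracles for \<open>location e\<close> are constant, so an answer depends on the
  index of the oracle alone.\<close>

definition perform :: "nat \<Rightarrow> nat \<Rightarrow> nat \<Rightarrow> nat" where
  "perform a e C =
    (if pfst a = 0 then C
     else if pfst a = 1 then pair (psnd (psnd a)) (pair (upd (pfst (psnd C)) 3 0)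
       (upd (psnd (psnd C)) 3 (answer (if pfst (psnd a) = 0 then 2 ^ (e + 2) else 2))))
     else pair (pfst (psnd a)) (pair (move_code (pfst (psnd C)) (psnd (psnd a)) (pfst e))
       (write_code (pfst (psnd C)) (psnd (psnd C)) (psnd (psnd a)) (pfst e))))"

lemma pr_perform: "pr A \<Longrightarrow> pr B \<Longrightarrow> pr D \<Longrightarrow> pr (\<lambda>v. perform (A v) (B v) (D v))"
  by (erule (2) pr_app3[rotated]) (unfold perform_def, intro pr_answer pr_move_code pr_write_code pr_intros)

text \<open>The start value 0 codes the initial configuration on input 0: state 0, all heads at cell
  0, all cells blank.\<close>

definition simulate :: "nat \<Rightarrow> nat \<Rightarrow> nat" where
  "simulate e n = rec_nat 0 (\<lambda>i C. perform (action_at e C) e C) n"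

lemma pr_simulate: "pr A \<Longrightarrow> pr B \<Longrightarrow> pr (\<lambda>v. simulate (A v) (B v))"
  by (erule (1) pr_app2[rotated]) (unfold simulate_def, intro pr_perform pr_action_at pr_intros)

text \<open>
  A single fraction on the output tape is less than \<open>1\<close> iff it starts with a minus sign or the slash
  at position \<open>p\<close> is followed by more than \<open>p\<close> strokes.
\<close>

definition accepts :: "nat \<Rightarrow> nat \<Rightarrow> bool" where
  "accepts e t \<longleftrightarrow> pfst (action_at e (simulate e (pfst t))) = 0 \<and>
    (get (get (psnd (psnd (simulate e (pfst t)))) 1) 0 = minus_sign \<or>
     get (get (psnd (psnd (simulate e (pfst t)))) 1) (2 * psnd t) = slash \<and>
     get (get (psnd (psnd (simulate e (pfst t)))) 1) (2 * (2 * psnd t + 1)) = stroke)"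

lemma pr_accepts: "pr A \<Longrightarrow> pr B \<Longrightarrow> pr (\<lambda>v. of_bool (accepts (A v) (B v)))"
  by (erule (1) pr_app2[rotated]) (unfold accepts_def, intro pr_simulate pr_action_at pr_intros)

section \<open>Correctness of the simulation\<close>

definition codes :: "machine \<Rightarrow> nat \<Rightarrow> bool" where
  "codes M e \<longleftrightarrow> pfst e = num_tapes M \<and>
    (\<forall>q<num_states M. \<forall>as. length as = num_tapes M \<and> (\<forall>a\<in>set as. a < num_symbols M) \<longrightarrow>
      get (psnd e) (pair q (list_encode (rev as))) = action_code (delta M q as))"

text \<open>The relevant part of the table is finite. The diagonal argument asks only that a code
  exists, not that it is computed from the machine.\<close>

lemma ex_codes: "\<exists>e. codes M e"
proof -
  let ?A = "{..<num_states M} \<times> {as. set as \<subseteq> {..<num_symbols M} \<and> length as = num_tapes M}"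
  let ?k = "\<lambda>(q, as). pair q (list_encode (rev as))"
  have "finite (?k ` ?A)"
    by (intro finite_imageI finite_cartesian_product finite_lists_length_eq) auto
  from ex_stream[OF this, of "\<lambda>k. action_code (delta M (pfst k) (rev (list_decode (psnd k))))"]
  obtain D where "\<forall>i\<in>?k ` ?A. get D i = action_code (delta M (pfst i) (rev (list_decode (psnd i))))"
    by blast
  then show ?thesis
    by (intro exI[of _ "pair (num_tapes M) D"]) (auto simp: codes_def subset_iff)
qed

definition represents :: "nat \<Rightarrow> nat \<Rightarrow> config \<Rightarrow> bool" where
  "represents n C c \<longleftrightarrow> pfst C = state c \<and>
    (\<forall>j<n. get (pfst (psnd C)) j = int_encode (head c j) \<and>
      (\<forall>z. get (get (psnd (psnd C)) j) (int_encode z) = cells c j z))"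

text \<open>The invariant that keeps the state and the scanned symbols within the part of the table
  that \<open>codes\<close> describes.\<close>

definition valid_config :: "machine \<Rightarrow> config \<Rightarrow> bool" where
  "valid_config M c \<longleftrightarrow> state c < num_states M \<and> (\<forall>j<num_tapes M. \<forall>z. cells c j z < num_symbols M)"

lemma action_at:
  assumes "codes M e" "represents (num_tapes M) C c" "valid_config M c"
  shows "action_at e C = action_code (delta M (state c) (scanned M c))"
proof -
  have "map (\<lambda>j. get (get (psnd (psnd C)) j) (get (pfst (psnd C)) j)) [0..<num_tapes M] = scanned M c"
    using assms(2) by (auto simp: scanned_def represents_def)
  moreover have "length (scanned M c) = num_tapes M" "\<forall>a\<in>set (scanned M c). a < num_symbols M"
    using assms(3) by (auto simp: scanned_def valid_config_def)
  ultimately show ?thesis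
    using assms by (simp add: action_at_def codes_def scan_code valid_config_def represents_def)
qed

lemma set_fraction_word: "set (fraction_word x) \<subseteq> {..<5}"
  by (cases x) (auto simp: nat_word_def)

lemma simulate_step:
  assumes "codes M e" "represents (num_tapes M) C c" "valid_config M c" "oracle_machine 2 M"
  defines "c' \<equiv> step M (\<lambda>i k. of_nat (location e i)) c"
  shows "represents (num_tapes M) (perform (action_at e C) e C) c' \<and> valid_config M c'"
proof -
  let ?T = "num_tapes M"
  have T: "pfst e = ?T" using assms(1) by (simp add: codes_def)
  have sc: "length (scanned M c) = ?T" "\<forall>a\<in>set (scanned M c). a < num_symbols M"
    using assms(3) by (auto simp: scanned_def valid_config_def)
  have va: "valid_action 2 M (delta M (state c) (scanned M c))" and sym: "5 \<le> num_symbols M" and "4 \<le> ?T"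
    using assms(3,4) sc by (auto simp: oracle_machine_def valid_config_def)
  show ?thesis
  proof (cases "delta M (state c) (scanned M c)")
    case Halt
    then have "c' = c" by (simp add: c'_def step_def)
    then show ?thesis using assms(2,3) Halt by (simp add: action_at[OF assms(1-3)] perform_def)
  next
    case (Query i q)
    have q: "quotient_of (of_nat n) = (int n, 1)" for n
      using quotient_of_int[of "int n"] by simp
    have "word_tape (fraction_word x) z < num_symbols M" for x z
      using set_fraction_word[of x] sym nth_mem[of "nat z" "fraction_word x"]
      by (auto simp: word_tape_def subset_iff nat_less_iff simp del: nth_mem)
    moreover have "(if i = 0 then 2 ^ (e + 2) else 2) = location e i" by (simp add: location_def)
    ultimately show ?thesis
      using assms(2,3) Query va
      by (auto simp: c'_def step_def action_at[OF assms(1-3)] perform_def represents_def valid_config_def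
          get_upd get_answer q int_encode_eqs(1)[of 0, simplified] simp del: fraction_word.simps)
  next
    case (Move q ws)
    then have ws: "length ws = ?T" "\<And>j. j < ?T \<Longrightarrow> fst (ws ! j) < num_symbols M" "q < num_states M"
      using va by (auto simp: case_prod_beta)
    define W where "W = foldr (\<lambda>(w, d) r. pair (pair w (direction_code d)) r) ws 0"
    have W: "pfst (get W j) = fst (ws ! j)" "psnd (get W j) = direction_code (snd (ws ! j))" if "j < ?T" for j
      using get_foldr_pair[of j ws] that ws(1) by (simp_all add: W_def)
    define H C' where "H = pfst (psnd C)" and "C' = psnd (psnd C)"
    have C: "get H j = int_encode (head c j)" "get (get C' j) (int_encode z) = cells c j z" if "j < ?T" for j z
      using assms(2) that by (simp_all add: represents_def H_def C'_def)
    have c': "c' = \<lparr>state = q,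
      cells = (\<lambda>j. if j < ?T then (cells c j)(head c j := fst (ws ! j)) else cells c j),
      head = (\<lambda>j. if j < ?T then head c j + shift (snd (ws ! j)) else head c j)\<rparr>"
      using Move by (simp add: c'_def step_def)
    have "perform (action_at e C) e C = pair q (pair (move_code H W ?T) (write_code H C' W ?T))"
      using Move by (simp add: action_at[OF assms(1-3)] perform_def T W_def H_def C'_def)
    moreover have "get (move_code H W ?T) j = int_encode (head c' j)" if "j < ?T" for j
      using that by (simp add: get_move_code W C shift_code c')
    moreover have "get (get (write_code H C' W ?T) j) (int_encode z) = cells c' j z" if "j < ?T" for j z
      using that by (simp add: get_write_code W C get_upd int_encode_eq c')
    ultimately show ?thesis
      using assms(3) ws(2,3) by (simp add: represents_def valid_config_def c')
  qed
qed

lemma simulate: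
  assumes "codes M e" "oracle_machine 2 M"
  defines "c \<equiv> \<lambda>n. (step M (\<lambda>i k. of_nat (location e i)) ^^ n) (initial 0)"
  shows "represents (num_tapes M) (simulate e n) (c n) \<and> valid_config M (c n)"
proof (induction n)
  case 0
  show ?case using assms(2)
    by (auto simp: c_def simulate_def represents_def valid_config_def initial_def word_tape_def nat_word_def
        oracle_machine_def int_encode_eqs(1)[of 0, simplified])
next
  case (Suc n)
  then show ?case
    using simulate_step[OF assms(1) _ _ assms(2), of "simulate e n" "c n"] by (simp add: simulate_def c_def)
qed

lemma step_halted: "halted M c \<Longrightarrow> (step M \<phi> ^^ n) c = c"
  by (induction n) (auto simp: halted_def step_def)

text \<open>\<open>outputs\<close> and \<open>accepts\<close> may refer to different halting times;
  both then see the same tapes.\<close>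

lemma halted_unique:
  assumes "halted M ((step M \<phi> ^^ m) c)" "halted M ((step M \<phi> ^^ n) c)"
  shows "(step M \<phi> ^^ m) c = (step M \<phi> ^^ n) c"
proof -
  have "(step M \<phi> ^^ m) c = (step M \<phi> ^^ n) c" if "m \<le> n" "halted M ((step M \<phi> ^^ m) c)" for m n
    using step_halted[OF that(2), where n = "n - m" and \<phi> = \<phi>] that(1)
    by (metis add_diff_cancel_right' le_add_diff_inverse comp_apply funpow_add add.commute)
  then show ?thesis using assms by (metis nat_le_linear)
qed

lemma accepts_iff:
  assumes "codes M e" "oracle_machine 2 M" "outputs M (\<lambda>i k. of_nat (location e i)) 0 [x]"
  shows "(\<exists>t. accepts e t) \<longleftrightarrow> x < 1"
proof -
  define c where "c n = (step M (\<lambda>i k. of_nat (location e i)) ^^ n) (initial 0)" for n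
  note sim = simulate[OF assms(1,2), folded c_def]
  obtain n fs where n: "halted M (c n)" and fs: "\<forall>(a, b)\<in>set fs. b > 0" "[x] = map fraction_value fs"
    and out: "cells (c n) 1 = word_tape (concat (map fraction_word fs))"
    using assms(3)[unfolded outputs_def Let_def, folded c_def] by (elim exE conjE) (rule that)
  obtain a b where ab: "fs = [(a, b)]" "b > 0" "x = of_int a / of_int b"
  proof -
    obtain p where p: "fs = [p]" "x = fraction_value p"
      using fs(2)[symmetric] by (auto simp: map_eq_Cons_conv)
    obtain a b where "p = (a, b)" by (cases p)
    then show thesis using that[of a b] fs(1) p by simp
  qed
  have T: "1 < num_tapes M" using assms(2) by (simp add: oracle_machine_def)
  have halt: "pfst (action_at e (simulate e m)) = 0 \<longleftrightarrow> halted M (c m)" for m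
  proof -
    have "pfst (action_code d) = 0 \<longleftrightarrow> d = Halt" for d by (cases d) auto
    then show ?thesis
      using action_at[OF assms(1) conjunct1[OF sim[of m]] conjunct2[OF sim[of m]]] by (simp add: halted_def)
  qed
  have cell: "get (get (psnd (psnd (simulate e m))) 1) (2 * k) = cells (c m) 1 (int k)" for m k
    using sim[of m] T by (simp add: represents_def flip: int_encode_eqs(1))
  have acc: "accepts e t \<longleftrightarrow> halted M (c (pfst t)) \<and> (cells (c n) 1 0 = minus_sign \<or>
      cells (c n) 1 (int (psnd t)) = slash \<and> cells (c n) 1 (int (2 * psnd t + 1)) = stroke)" for t
  proof (cases "halted M (c (pfst t))")
    case True
    then have "c (pfst t) = c n" using halted_unique n by (simp add: c_def)
    then show ?thesis
      using cell[of "pfst t" 0, unfolded mult_0_right of_nat_0] unfolding accepts_def halt cell by simp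
  next
    case False
    then show ?thesis by (simp add: accepts_def halt)
  qed
  have x: "x < 1 \<longleftrightarrow> a < b" using ab by simp
  have ex: "(\<exists>t. accepts e t) \<longleftrightarrow> cells (c n) 1 0 = minus_sign \<or>
      (\<exists>p. cells (c n) 1 (int p) = slash \<and> cells (c n) 1 (int (2 * p + 1)) = stroke)"
    using acc n by (metis pair_simps(1,2))
  show ?thesis
  proof (cases "a < 0")
    case True
    then show ?thesis using ab unfolding ex x out by (simp add: word_tape_def)
  next
    case False
    define k l where "k = nat a" and "l = nat b"
    have kl: "a = int k" "b = int l" using False ab(2) by (simp_all add: k_def l_def)
    have w: "cells (c n) 1 (int p) = (if p < k then stroke else if p = k then slash
      else if p < k + 1 + l then stroke else if p = k + 1 + l then end_mark else blank)" for p
      using word_tape_fraction_word[of k l p] unfolding out ab(1) kl by (simp del: fraction_word.simps)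
    have "cells (c n) 1 0 \<noteq> minus_sign" using w[of 0] by (simp split: if_splits)
    moreover have "cells (c n) 1 (int p) = slash \<longleftrightarrow> p = k" for p
      using w[of p] by (simp split: if_splits)
    \<comment> \<open>The denominator fills the cells \<open>k + 1\<close> to \<open>k + l\<close>,
      and \<open>2 * k + 1\<close> is among them iff \<open>k < l\<close>.\<close>
    moreover have "cells (c n) 1 (int (2 * k + 1)) = stroke \<longleftrightarrow> k < l"
      using w[of "2 * k + 1"] by (simp split: if_splits)
    ultimately show ?thesis
      unfolding ex x kl by auto
  qed
qed

section \<open>Computing functions of the plane\<close>

text \<open>A tape in the course of being written: the head is just behind the word.\<close>

definition put :: "nat \<Rightarrow> nat list \<Rightarrow> mem \<Rightarrow> mem" where
  "put j w X = ((fst X)(j := word_tape w), (snd X)(j := int (length w)))"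

lemma put_put [simp]: "put j w (put j w' X) = put j w X"
  by (simp add: put_def)

lemma put_twist: "i \<noteq> j \<Longrightarrow> put i u (put j w X) = put j w (put i u X)"
  by (simp add: put_def fun_upd_twist)

lemma exec_act:
  "j < 4 \<Longrightarrow> exec \<phi> (Act j x d) (conf \<rho> X)
    (conf \<rho> ((fst X)(j := (fst X j)(snd X j := x)), (snd X)(j := snd X j + shift d)))"
  unfolding conf_def by (rule exec_eq[OF exec.Act]) (auto simp: fun_eq_iff)

lemma exec_skip:
  assumes "j < 4" "fst X j (snd X j) = x"
  shows "exec \<phi> (Act j x d) (conf \<rho> X) (conf \<rho> (fst X, (snd X)(j := snd X j + shift d)))"
  using exec_act[OF assms(1), of \<phi> x d \<rho> X] assms(2) by (simp add: fun_upd_idem)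

lemma exec_emit: "j < 4 \<Longrightarrow> exec \<phi> (Act j x Right) (conf \<rho> (put j w X)) (conf \<rho> (put j (w @ [x]) X))"
  by (rule exec_eq[OF exec_act]) (auto simp: put_def word_tape_snoc add.commute)

lemma exec_loop_emit:
  assumes "j < 4"
  shows "exec \<phi> (loop r (Act j x Right)) (conf \<rho> (put j w X))
    (conf (\<rho>(r := 0)) (put j (w @ replicate (\<rho> r) x) X))"
proof -
  have "exec \<phi> (loop r (Act j x Right)) (conf (\<rho>(r := \<rho> r - 0)) (put j (w @ replicate 0 x) X))
    (conf (\<rho>(r := \<rho> r - \<rho> r)) (put j (w @ replicate (\<rho> r) x) X))"
    using assms
    by (intro exec_loop[where \<rho> = "\<lambda>i. \<rho>(r := \<rho> r - i)" and X = "\<lambda>i. put j (w @ replicate i x) X"]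
        exec_eq[OF exec_emit]) (auto simp: replicate_append_same)
  then show ?thesis by simp
qed

text \<open>In the induction each symbol read passes from the block to the prefix \<open>u\<close>;
  the delimiter \<open>y\<close>, possibly a blank, ends the loop.\<close>

lemma exec_read:
  assumes "j < 4" "fst X j = word_tape (u @ replicate n x @ y # v)" "snd X j = int (length u)" "x \<noteq> y"
  shows "exec \<phi> (While j x (inc r ;; Act j x Right)) (conf \<rho> X)
    (conf (\<rho>(r := \<rho> r + n)) (fst X, (snd X)(j := int (length u + n))))"
  using assms(2,3)
proof (induction n arbitrary: u \<rho> X)
  case 0
  then have "fst (conf \<rho> X) j (snd (conf \<rho> X) j) \<noteq> x"
    using assms(1,4) by (simp add: conf_def word_tape_def nth_append)
  from exec.WhileF[of "fst (conf \<rho> X)" j "snd (conf \<rho> X)", OF this] show ?case using 0 by (cases X) (simp add: fun_upd_idem)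
next
  case (Suc n)
  have x: "fst X j (snd X j) = x"
    using Suc.prems by (simp add: word_tape_def nth_append)
  define X1 where "X1 = (fst X, (snd X)(j := snd X j + 1))"
  have "exec \<phi> (inc r ;; Act j x Right) (conf \<rho> X) (conf (\<rho>(r := Suc (\<rho> r))) X1)"
    by (rule exec.Seq[OF exec_inc exec_eq[OF exec_skip]]) (use assms(1) x in \<open>auto simp: X1_def\<close>)
  moreover have "exec \<phi> (While j x (inc r ;; Act j x Right)) (conf (\<rho>(r := Suc (\<rho> r))) X1)
    (conf (\<rho>(r := \<rho> r + Suc n)) (fst X, (snd X)(j := int (length u + Suc n))))"
    by (rule exec_eq[OF Suc.IH[of X1 "u @ [x]" "\<rho>(r := Suc (\<rho> r))"]])
      (use Suc.prems in \<open>auto simp: X1_def fun_eq_iff intro!: arg_cong2[of _ _ _ _ conf]\<close>)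
  moreover have "fst (conf \<rho> X) j (snd (conf \<rho> X) j) = x"
    using assms(1) x by (simp add: conf_def)
  ultimately show ?case
    using exec.WhileT[of "fst (conf \<rho> X)" j "snd (conf \<rho> X)" x] unfolding prod.collapse by blast
qed

text \<open>The optional minus sign is read by a loop that runs at most once, so \<open>s\<close>
  ends as 0 or 1.\<close>

definition query :: "nat \<Rightarrow> nat \<Rightarrow> nat \<Rightarrow> nat \<Rightarrow> com" where
  "query i s n d = Ask i ;; While 3 minus_sign (inc s ;; Act 3 minus_sign Right) ;;
     While 3 stroke (inc n ;; Act 3 stroke Right) ;; Act 3 slash Right ;;
     While 3 stroke (inc d ;; Act 3 stroke Right)"

lemma Least_nat_word: "(LEAST k. word_tape (nat_word m) (int k) \<noteq> stroke) = m"
proof -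
  have "word_tape (nat_word m) (int k) = (if k < m then stroke else blank)" for k
    by (simp add: word_tape_def nat_word_def)
  then show ?thesis by (intro Least_equality) (auto split: if_splits)
qed

text \<open>The existential hides the answer tape; the next query overwrites it anyway.\<close>

lemma exec_query:
  assumes "distinct [s, n, d]" "\<rho> s = 0" "\<rho> n = 0" "\<rho> d = 0" "quotient_of (\<phi> i m) = (a, b)"
  shows "\<exists>Y'. exec \<phi> (query i s n d) (conf \<rho> (put 1 u (put 2 (nat_word m) Y)))
    (conf (\<rho>(s := of_bool (a < 0), n := nat \<bar>a\<bar>, d := nat b)) (put 1 u (put 2 (nat_word m) Y')))"
proof -
  define X where "X = put 1 u (put 2 (nat_word m) Y)"
  define l where "l = replicate (of_bool (a < 0)) minus_sign"
  define A B where "A = nat \<bar>a\<bar>" and "B = nat b"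
  have w: "fraction_word (a, b) = l @ replicate A stroke @ slash # replicate B stroke @ [end_mark]"
    by (auto simp: l_def A_def B_def nat_word_def)
  define C where "C = (fst X)(3 := word_tape (l @ replicate A stroke @ slash # replicate B stroke @ [end_mark]))"
  define H where "H p = (snd X)(3 := int p)" for p
  have "(LEAST k. fst X 2 (int k) \<noteq> stroke) = m"
    using Least_nat_word by (simp add: X_def put_def)
  then have 1: "exec \<phi> (Ask i) (conf \<rho> X) (conf \<rho> (C, H 0))"
    unfolding conf_def
    by (intro exec_eq[OF exec.Ask]) (auto simp: fun_eq_iff C_def H_def assms(5) w simp del: fraction_word.simps)
  have l: "length l = of_bool (a < 0)" by (simp add: l_def)
  have 2: "exec \<phi> (While 3 minus_sign (inc s ;; Act 3 minus_sign Right)) (conf \<rho> (C, H 0))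
    (conf (\<rho>(s := of_bool (a < 0))) (C, H (length l)))"
  proof -
    obtain y v where "replicate A stroke @ slash # replicate B stroke @ [end_mark] = y # v" "y \<noteq> minus_sign"
      by (cases A) auto
    then show ?thesis
      by (intro exec_eq[OF exec_read[of 3 "(C, H 0)" "[]" "of_bool (a < 0)" minus_sign y v]])
        (use assms(2) in \<open>auto simp: C_def H_def l_def fun_eq_iff intro!: arg_cong2[of _ _ _ _ conf]\<close>)
  qed
  have 3: "exec \<phi> (While 3 stroke (inc n ;; Act 3 stroke Right)) (conf (\<rho>(s := of_bool (a < 0))) (C, H (length l)))
    (conf (\<rho>(s := of_bool (a < 0), n := A)) (C, H (length l + A)))"
    by (rule exec_eq[OF exec_read[of 3 "(C, H (length l))" l A stroke slash "replicate B stroke @ [end_mark]"]])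
      (use assms(1,3) in \<open>auto simp: C_def H_def fun_eq_iff intro!: arg_cong2[of _ _ _ _ conf]\<close>)
  have 4: "exec \<phi> (Act 3 slash Right) (conf \<rho>' (C, H (length l + A))) (conf \<rho>' (C, H (length l + A + 1)))" for \<rho>'
    by (rule exec_eq[OF exec_skip])
      (auto simp: C_def H_def word_tape_def nth_append fun_eq_iff intro!: arg_cong2[of _ _ _ _ conf])
  have 5: "exec \<phi> (While 3 stroke (inc d ;; Act 3 stroke Right))
    (conf (\<rho>(s := of_bool (a < 0), n := A)) (C, H (length l + A + 1)))
    (conf (\<rho>(s := of_bool (a < 0), n := A, d := B)) (C, H (length l + A + 1 + B)))"
    by (rule exec_eq[OF exec_read[of 3 "(C, H (length l + A + 1))" "l @ replicate A stroke @ [slash]" B stroke end_mark "[]"]])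
      (use assms(1,4) in \<open>auto simp: C_def H_def fun_eq_iff intro!: arg_cong2[of _ _ _ _ conf]\<close>)
  have "put 1 u (put 2 (nat_word m) (C, H q)) = (C, H q)" for q
    by (auto simp: put_def C_def H_def X_def fun_eq_iff)
  then show ?thesis
    using exec.Seq[OF 1 exec.Seq[OF 2 exec.Seq[OF 3 exec.Seq[OF 4 5]]]] unfolding query_def A_def B_def X_def
    by metis
qed

lemma word_tape_blank: "word_tape (w @ [blank]) = word_tape w"
  by (auto simp: word_tape_def fun_eq_iff nth_append)

text \<open>Layout: 0 holds \<open>k\<close>; 1 to 3 the answer at precision 0; 4 to 6 and 7 to 9
  the answers for both coordinates at precision \<open>m\<close>; 10 holds \<open>m\<close>. All
  later variables are read from register 0, hence the default \<open>k\<close>.\<close>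

definition inputs :: "(nat \<Rightarrow> nat \<Rightarrow> nat) \<Rightarrow> (nat \<Rightarrow> nat \<Rightarrow> rat) \<Rightarrow> nat \<Rightarrow> nat \<Rightarrow> nat" where
  "inputs \<mu> \<phi> k = (let frac = \<lambda>(a, b). [of_bool (a < 0), nat \<bar>a\<bar>, nat b];
     q = quotient_of (\<phi> 0 0); m = \<mu> k (nat \<bar>fst q\<bar>) in
     (\<lambda>i. if i < 11 then (k # frac q @ frac (quotient_of (\<phi> 0 m)) @ frac (quotient_of (\<phi> 1 m)) @ [m]) ! i
       else k))"

lemma compile_inputs:
  assumes "pr F" "11 \<le> N"
  shows "\<exists>c. wf_com 0 c \<and> (\<forall>\<phi> \<rho> X. (\<forall>i\<ge>N. \<rho> i = 0) \<longrightarrow>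
    exec \<phi> c (conf \<rho> X) (conf (\<rho>(N := F (\<lambda>i. \<rho> (if i < 11 then i else 0)))) X))"
  using pr_compiled[OF assms(1), unfolded compiled_def, rule_format, of "\<lambda>i. if i < 11 then i else 0" N] assms(2)
  by simp

text \<open>
  The machine gets a bound on the first coordinate from the oracle answer at \<open>0\<close>, computes from it
  the precision \<open>\<mu>\<close> at which it queries both coordinates, and outputs \<open>0\<close> and a fraction with sign
  \<open>S\<close>, numerator \<open>P\<close> and denominator \<open>Q\<close>.
\<close>

lemma computable_functionI:
  assumes pr: "pr (\<lambda>v. \<mu> (v 0) (v 2))" "pr S" "pr P" "pr Q"
    and F: "\<And>x \<phi> k. x \<in> carrier_vec 2 \<Longrightarrow> is_oracle_vec 2 \<phi> x \<Longrightarrow> F x $ 0 = 0"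
    "\<And>x \<phi> k. x \<in> carrier_vec 2 \<Longrightarrow> is_oracle_vec 2 \<phi> x \<Longrightarrow>
       Q (inputs \<mu> \<phi> k) > 0 \<and> (S (inputs \<mu> \<phi> k) = 0 \<or> S (inputs \<mu> \<phi> k) = 1 \<and> P (inputs \<mu> \<phi> k) > 0) \<and>
       \<bar>(-1) ^ S (inputs \<mu> \<phi> k) * real (P (inputs \<mu> \<phi> k)) / real (Q (inputs \<mu> \<phi> k)) - F x $ 1\<bar> < 1 / 2 ^ k"
  shows "computable_function 2 2 F"
proof -
  obtain cM where cM: "wf_com 0 cM" "\<forall>\<phi> \<rho> X. (\<forall>i\<ge>11. \<rho> i = 0) \<longrightarrow>
    exec \<phi> cM (conf \<rho> X) (conf (\<rho>(11 := \<mu> (\<rho> 0) (\<rho> 2))) X)"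
    using compile_inputs[OF pr(1), of 11] by auto
  obtain cS where cS: "wf_com 0 cS" "\<forall>\<phi> \<rho> X. (\<forall>i\<ge>11. \<rho> i = 0) \<longrightarrow>
    exec \<phi> cS (conf \<rho> X) (conf (\<rho>(11 := S (\<lambda>i. \<rho> (if i < 11 then i else 0)))) X)"
    using compile_inputs[OF pr(2), of 11] by auto
  obtain cP where cP: "wf_com 0 cP" "\<forall>\<phi> \<rho> X. (\<forall>i\<ge>12. \<rho> i = 0) \<longrightarrow>
    exec \<phi> cP (conf \<rho> X) (conf (\<rho>(12 := P (\<lambda>i. \<rho> (if i < 11 then i else 0)))) X)"
    using compile_inputs[OF pr(3), of 12] by auto
  obtain cQ where cQ: "wf_com 0 cQ" "\<forall>\<phi> \<rho> X. (\<forall>i\<ge>13. \<rho> i = 0) \<longrightarrow>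
    exec \<phi> cQ (conf \<rho> X) (conf (\<rho>(13 := Q (\<lambda>i. \<rho> (if i < 11 then i else 0)))) X)"
    using compile_inputs[OF pr(4), of 13] by auto
  \<comment> \<open>The loop on register 11 writes \<open>m\<close> to register 10 and to the query
    tape at once; both later queries reuse that tape, while the first one finds it empty and so asks
    for precision 0. The first three symbols written on tape 1 are the component
    \<open>0 / 1\<close>.\<close>
  define c where "c =
    While 0 stroke (inc 0 ;; Act 0 stroke Right) ;; query 0 1 2 3 ;; cM ;; loop 11 (inc 10 ;; Act 2 stroke Right) ;;
    query 0 4 5 6 ;; query 1 7 8 9 ;; cS ;; cP ;; cQ ;;
    Act 1 slash Right ;; Act 1 stroke Right ;; Act 1 end_mark Right ;;
    loop 11 (Act 1 minus_sign Right) ;; loop 12 (Act 1 stroke Right) ;; Act 1 slash Right ;;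
    loop 13 (Act 1 stroke Right) ;; Act 1 end_mark Right"
  have wf: "wf_com 2 c"
    using cM(1) cS(1) cP(1) cQ(1) by (auto simp: c_def query_def intro: wf_com_mono)
  have "\<exists>qs. outputs (machine_of c) \<phi> k qs \<and> length qs = 2 \<and> (\<forall>i<2. \<bar>of_rat (qs ! i) - F x $ i\<bar> < 1 / 2 ^ k)"
    if x: "x \<in> carrier_vec 2" "is_oracle_vec 2 \<phi> x" for x \<phi> k
  proof -
    obtain a0 b0 where q0: "quotient_of (\<phi> 0 0) = (a0, b0)" by fastforce
    define m where "m = \<mu> k (nat \<bar>a0\<bar>)"
    obtain a1 b1 where q1: "quotient_of (\<phi> 0 m) = (a1, b1)" by fastforce
    obtain a2 b2 where q2: "quotient_of (\<phi> 1 m) = (a2, b2)" by fastforce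
    define X0 :: mem where "X0 = (\<lambda>j. word_tape (if j = 0 then nat_word k else []), \<lambda>_. 0)"
    define \<rho>1 :: "nat \<Rightarrow> nat" where "\<rho>1 = (\<lambda>_. 0)(0 := k)"
    define \<rho>2 where "\<rho>2 = \<rho>1(1 := of_bool (a0 < 0), 2 := nat \<bar>a0\<bar>, 3 := nat b0)"
    define \<rho>3 where "\<rho>3 = \<rho>2(10 := m)"
    define \<rho>4 where "\<rho>4 = \<rho>3(4 := of_bool (a1 < 0), 5 := nat \<bar>a1\<bar>, 6 := nat b1)"
    define \<rho>5 where "\<rho>5 = \<rho>4(7 := of_bool (a2 < 0), 8 := nat \<bar>a2\<bar>, 9 := nat b2)"
    note \<rho>_defs = \<rho>1_def \<rho>2_def \<rho>3_def \<rho>4_def \<rho>5_def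
    have v: "inputs \<mu> \<phi> k = (\<lambda>i. \<rho>5 (if i < 11 then i else 0))"
      unfolding inputs_def Let_def q0 fst_conv m_def[symmetric] q1 q2
      by (auto simp: \<rho>_defs fun_eq_iff nth_Cons' less_Suc_eq numeral_eq_Suc)
    have 1: "\<exists>Y. exec \<phi> (While 0 stroke (inc 0 ;; Act 0 stroke Right)) X0 (conf \<rho>1 (put 1 [] (put 2 (nat_word 0) Y)))"
    proof -
      define Y where "Y = (fst X0, (snd X0)(0 := int k))"
      have "put 1 [] (put 2 (nat_word 0) Y) = Y"
        by (auto simp: put_def Y_def X0_def nat_word_def fun_eq_iff)
      moreover have "conf (\<lambda>_. 0) X0 = X0"
        by (auto simp: conf_def X0_def nat_word_def fun_eq_iff)
      moreover have "fst X0 0 = word_tape ([] @ replicate k stroke @ blank # [])"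
        using word_tape_blank[of "nat_word k"] by (simp add: X0_def nat_word_def)
      ultimately show ?thesis
        using exec_read[of 0 X0 "[]" k stroke blank "[]" \<phi> 0 "\<lambda>_. 0"]
        by (intro exI[of _ Y]) (simp add: X0_def Y_def \<rho>1_def)
    qed
    then obtain Y1 where 1: "exec \<phi> (While 0 stroke (inc 0 ;; Act 0 stroke Right)) X0
      (conf \<rho>1 (put 1 [] (put 2 (nat_word 0) Y1)))" by blast
    obtain Y2 where 2: "exec \<phi> (query 0 1 2 3) (conf \<rho>1 (put 1 [] (put 2 (nat_word 0) Y1)))
      (conf \<rho>2 (put 1 [] (put 2 (nat_word 0) Y2)))"
      unfolding \<rho>2_def using exec_query[of 1 2 3 \<rho>1 \<phi> 0 0 a0 b0 "[]" Y1] q0 by (auto simp: \<rho>1_def)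
    have 3: "exec \<phi> cM (conf \<rho>2 X) (conf (\<rho>2(11 := m)) X)" for X
      by (rule exec_eq[OF cM(2)[rule_format]]) (auto simp: \<rho>_defs m_def)
    have 4: "exec \<phi> (loop 11 (inc 10 ;; Act 2 stroke Right))
      (conf (\<rho>2(11 := m)) (put 1 [] (put 2 (nat_word 0) Y2))) (conf \<rho>3 (put 1 [] (put 2 (nat_word m) Y2)))"
    proof -
      have "exec \<phi> (loop 11 (inc 10 ;; Act 2 stroke Right))
        (conf (\<rho>2(11 := m - 0, 10 := 0)) (put 2 (nat_word 0) (put 1 [] Y2)))
        (conf (\<rho>2(11 := m - m, 10 := m)) (put 2 (nat_word m) (put 1 [] Y2)))"
        by (intro exec_loop[where \<rho> = "\<lambda>i. \<rho>2(11 := m - i, 10 := i)" and X = "\<lambda>i. put 2 (nat_word i) (put 1 [] Y2)"]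
            exec.Seq[OF exec_inc exec_eq[OF exec_emit]])
          (auto simp: nat_word_def replicate_append_same fun_eq_iff intro!: arg_cong2[of _ _ _ _ conf])
      moreover have "\<rho>2(11 := m - 0, 10 := 0) = \<rho>2(11 := m)" "\<rho>2(11 := m - m, 10 := m) = \<rho>3"
        by (auto simp: \<rho>_defs fun_eq_iff)
      moreover have "put 1 [] (put 2 u X) = put 2 u (put 1 [] X)" for u X
        by (rule put_twist) simp
      ultimately show ?thesis by (simp only:)
    qed
    obtain Y3 where 5: "exec \<phi> (query 0 4 5 6) (conf \<rho>3 (put 1 [] (put 2 (nat_word m) Y2)))
      (conf \<rho>4 (put 1 [] (put 2 (nat_word m) Y3)))"
      unfolding \<rho>4_def using exec_query[of 4 5 6 \<rho>3 \<phi> 0 m a1 b1 "[]" Y2] q1 by (auto simp: \<rho>_defs)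
    obtain Y4 where 6: "exec \<phi> (query 1 7 8 9) (conf \<rho>4 (put 1 [] (put 2 (nat_word m) Y3)))
      (conf \<rho>5 (put 1 [] (put 2 (nat_word m) Y4)))"
      unfolding \<rho>5_def using exec_query[of 7 8 9 \<rho>4 \<phi> 1 m a2 b2 "[]" Y3] q2 by (auto simp: \<rho>_defs)
    define s p q where "s = S (inputs \<mu> \<phi> k)" and "p = P (inputs \<mu> \<phi> k)" and "q = Q (inputs \<mu> \<phi> k)"
    have 7: "exec \<phi> cS (conf \<rho>5 X) (conf (\<rho>5(11 := s)) X)" for X
      unfolding s_def v by (rule cS(2)[rule_format]) (auto simp: \<rho>_defs)
    have idx: "(if i < 11 then i else 0) \<noteq> 11" "(if i < 11 then i else 0) \<noteq> 12" for i :: nat by auto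
    have zero: "\<rho>5 i = 0" if "11 \<le> i" for i using that by (simp add: \<rho>_defs)
    have 8: "exec \<phi> cP (conf (\<rho>5(11 := s)) X) (conf (\<rho>5(11 := s, 12 := p)) X)" for X
      unfolding p_def v by (rule exec_eq[OF cP(2)[rule_format]]) (simp_all add: zero idx)
    have 9: "exec \<phi> cQ (conf (\<rho>5(11 := s, 12 := p)) X) (conf (\<rho>5(11 := s, 12 := p, 13 := q)) X)" for X
      unfolding q_def v by (rule exec_eq[OF cQ(2)[rule_format]]) (simp_all add: zero idx)
    define w where "w = [slash, stroke, end_mark] @ replicate s minus_sign @ replicate p stroke @ [slash] @
      replicate q stroke @ [end_mark]"
    have "exec \<phi> c X0 (conf (\<rho>5(11 := s, 12 := p, 13 := q, 11 := 0, 12 := 0, 13 := 0)) (put 1 w (put 2 (nat_word m) Y4)))"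
      unfolding c_def
      by (intro exec.Seq[OF 1] exec.Seq[OF 2] exec.Seq[OF 3] exec.Seq[OF 4] exec.Seq[OF 5] exec.Seq[OF 6]
          exec.Seq[OF 7] exec.Seq[OF 8] exec.Seq[OF 9] exec.Seq[OF exec_emit] exec.Seq[OF exec_loop_emit]
          exec_eq[OF exec_emit]) (auto simp: w_def)
    then obtain C H where CH: "exec \<phi> c (\<lambda>j. word_tape (if j = 0 then nat_word k else []), \<lambda>_. 0) (C, H)"
      and out: "C 1 = word_tape w"
      by (auto simp: X0_def conf_def put_def)
    define fs where "fs = [(0, 1), ((-1) ^ s * int p, int q)]"
    have s: "q > 0" "s = 0 \<or> s = 1 \<and> p > 0" and
      est: "\<bar>(-1) ^ s * real p / real q - F x $ 1\<bar> < 1 / 2 ^ k"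
      using F(2)[OF x] unfolding s_def p_def q_def by auto
    \<comment> \<open>A minus sign before numerator 0 is not the word of any fraction; this is why
      sign 1 comes with a positive numerator.\<close>
    have w: "w = concat (map fraction_word fs)"
      using s by (auto simp: w_def fs_def nat_word_def)
    have "outputs (machine_of c) \<phi> k (map fraction_value fs)"
    proof (rule outputs_machine_of[OF CH wf])
      show "\<forall>(a, b)\<in>set fs. 0 < b" using s(1) by (simp add: fs_def)
      show "C 1 = word_tape (concat (map fraction_word fs))" by (simp only: out w)
    qed
    moreover have "\<bar>of_rat (map fraction_value fs ! i) - F x $ i\<bar> < 1 / 2 ^ k" if "i < 2" for i
      using that est F(1)[OF x] by (cases i) (auto simp: fs_def less_Suc_eq numeral_2_eq_2 of_rat_mult of_rat_divide of_rat_power)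
    ultimately show ?thesis
      by (intro exI[of _ "map fraction_value fs"]) (auto simp: fs_def)
  qed
  then show ?thesis
    unfolding computable_function_def using oracle_machine_of[OF wf] by blast
qed

lemma computable_point_0_1:
  fixes s :: "real vec"
  assumes "s $ 0 = 0" "s $ 1 = 1"
  shows "computable_point 2 s"
proof -
  define c where "c = Act 1 slash Right ;; Act 1 stroke Right ;; Act 1 end_mark Right ;;
    Act 1 stroke Right ;; Act 1 slash Right ;; Act 1 stroke Right ;; Act 1 end_mark Right"
  have wf: "wf_com 0 c" by (simp add: c_def)
  have "outputs (machine_of c) (\<lambda>_ _. 0) k [0, 1]" for k
  proof -
    define X0 :: mem where "X0 = (\<lambda>j. word_tape (if j = 0 then nat_word k else []), \<lambda>_. 0)"
    define w where "w = [slash, stroke, end_mark, stroke, slash, stroke, end_mark]"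
    have X0: "conf (\<lambda>_. 0) (put 1 [] X0) = X0"
      by (auto simp: conf_def X0_def put_def nat_word_def fun_eq_iff)
    have "exec (\<lambda>_ _. 0) c (conf (\<lambda>_. 0) (put 1 [] X0)) (conf (\<lambda>_. 0) (put 1 w X0))"
      unfolding c_def by (intro exec.Seq[OF exec_emit] exec_eq[OF exec_emit]) (auto simp: w_def)
    then obtain C H where CH: "exec (\<lambda>_ _. 0) c (\<lambda>j. word_tape (if j = 0 then nat_word k else []), \<lambda>_. 0) (C, H)"
      and out: "C 1 = word_tape w"
      unfolding X0 by (auto simp: X0_def conf_def put_def)
    have "w = concat (map fraction_word [(0, 1), (1, 1)])"
      by (simp add: w_def nat_word_def)
    then show ?thesis
      using outputs_machine_of[OF CH wf, of "[(0, 1), (1, 1)]"] out by simp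
  qed
  moreover have "map (\<lambda>i. (\<lambda>i k. of_nat i :: rat) i k) [0..<2] = [0, 1]" for k :: nat
    by (simp add: numeral_2_eq_2)
  moreover have "is_oracle_vec 2 (\<lambda>i k. of_nat i) s"
    using assms by (auto simp: is_oracle_vec_def is_oracle_def numeral_2_eq_2 less_Suc_eq)
  ultimately show ?thesis
    unfolding computable_point_def using oracle_machine_of[OF wf]
    by (intro exI[of _ "machine_of c"] exI[of _ "\<lambda>i k. of_nat i"]) simp
qed

section \<open>An infinite product\<close>

text \<open>Polymorphic, so that the product can be shown holomorphic over the complex numbers and
  then restricted to the reals.\<close>

definition factor :: "real \<Rightarrow> nat \<Rightarrow> 'a :: real_normed_field \<Rightarrow> 'a" where
  "factor \<beta> e x = (1 - x / 2 ^ (e + 2))\<^sup>2 + of_real \<beta> * (x / 2 ^ (e + 2))\<^sup>2"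

definition weight :: "(nat \<Rightarrow> real) \<Rightarrow> 'a :: {real_normed_field, banach} \<Rightarrow> 'a" where
  "weight b x = (\<Prod>e. factor (b e) e x)"

lemma factor_of_real: "factor \<beta> e (of_real x) = of_real (factor \<beta> e x)"
  by (simp add: factor_def)

lemma factor_eq_0_iff: "0 \<le> \<beta> \<Longrightarrow> factor \<beta> e x = 0 \<longleftrightarrow> x = 2 ^ (e + 2) \<and> \<beta> = 0" for x :: real
  by (auto simp: factor_def add_nonneg_eq_0_iff)

lemma factor_nonneg: "0 \<le> \<beta> \<Longrightarrow> 0 \<le> factor \<beta> e x" for x :: real
  by (simp add: factor_def)

text \<open>With \<open>y = x / 2 ^ (e + 2)\<close> the difference is
  \<open>(1 + \<beta>) * y^2 - 2 * y\<close>. This geometric majorant gives convergence, locally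
  uniform convergence and the tail estimate.\<close>

lemma norm_factor_minus_1:
  assumes "0 \<le> \<beta>" "\<beta> \<le> 1" "norm x \<le> R"
  shows "norm (factor \<beta> e x - 1) \<le> (R + R\<^sup>2) / 2 ^ e"
proof -
  define y where "y = x / 2 ^ (e + 2)"
  have R: "0 \<le> R" using assms(3) norm_ge_zero order_trans by blast
  have y: "norm y \<le> R / 2 ^ e / 4"
    using assms(3) by (simp add: y_def norm_divide norm_power field_simps)
  have "(norm y)\<^sup>2 \<le> (R / 2 ^ e / 4)\<^sup>2" using y by (intro power_mono) auto
  also have "\<dots> = R\<^sup>2 / 2 ^ e / 16 / 2 ^ e" by (simp add: power2_eq_square)
  also have "\<dots> \<le> R\<^sup>2 / 2 ^ e / 16 / 1" by (intro divide_left_mono) auto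
  finally have y2: "(norm y)\<^sup>2 \<le> R\<^sup>2 / 2 ^ e / 16" by simp
  have "factor \<beta> e x - 1 = of_real (1 + \<beta>) * y\<^sup>2 - 2 * y"
    unfolding factor_def y_def[symmetric] by (simp add: power2_eq_square algebra_simps)
  then have "norm (factor \<beta> e x - 1) \<le> norm (of_real (1 + \<beta>) * y\<^sup>2) + norm (2 * y)"
    using norm_triangle_ineq4[of "of_real (1 + \<beta>) * y\<^sup>2" "2 * y"] by (simp only:)
  also have "\<dots> = (1 + \<beta>) * (norm y)\<^sup>2 + 2 * norm y"
    using assms(1) by (simp add: norm_mult norm_power del: of_real_add)
  also have "\<dots> \<le> 2 * (norm y)\<^sup>2 + 2 * norm y"
    using assms(2) by (intro add_right_mono mult_right_mono) auto
  also have "\<dots> \<le> 2 * (R\<^sup>2 / 2 ^ e / 16) + 2 * (R / 2 ^ e / 4)"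
    using y y2 by linarith
  also have "\<dots> \<le> (R + R\<^sup>2) / 2 ^ e"
    using R by (simp add: field_simps)
  finally show ?thesis .
qed

lemma summable_const_div_power: "summable (\<lambda>e. c / 2 ^ e :: real)"
proof -
  have "summable (\<lambda>e. c * (1 / 2) ^ e)" by (intro summable_mult summable_geometric) simp
  then show ?thesis by (simp add: power_divide)
qed

lemma convergent_prod_factor:
  fixes x :: "'a :: {real_normed_field, banach}"
  assumes "\<And>e. 0 \<le> b e" "\<And>e. b e \<le> 1"
  shows "convergent_prod (\<lambda>e. factor (b e) e x)"
proof -
  have "summable (\<lambda>e. norm (factor (b e) e x - 1))"
    by (rule summable_comparison_test'[OF summable_const_div_power[of "norm x + (norm x)\<^sup>2"], of 0])
      (simp add: norm_factor_minus_1 assms)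
  then show ?thesis
    by (intro abs_convergent_prod_imp_convergent_prod) (simp add: abs_convergent_prod_conv_summable)
qed

lemma weight_LIMSEQ:
  assumes "\<And>e. 0 \<le> b e" "\<And>e. b e \<le> 1"
  shows "(\<lambda>n. \<Prod>e<n. factor (b e) e x) \<longlonglongrightarrow> weight b x"
  using convergent_prod_LIMSEQ[OF convergent_prod_factor[OF assms, where x = x]]
  by (simp add: weight_def LIMSEQ_lessThan_iff_atMost)

lemma weight_of_real:
  assumes "\<And>e. 0 \<le> b e" "\<And>e. b e \<le> 1"
  shows "weight b (of_real x :: 'a :: {real_normed_field, banach}) = of_real (weight b x)"
proof -
  have "(\<lambda>n. of_real (\<Prod>e<n. factor (b e) e x) :: 'a) \<longlonglongrightarrow> of_real (weight b x)"
    by (intro tendsto_of_real weight_LIMSEQ assms)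
  then show ?thesis
    using LIMSEQ_unique[OF weight_LIMSEQ[OF assms, where x = "of_real x :: 'a"]] by (simp add: factor_of_real)
qed

lemma weight_0: "weight b 0 = 1"
  by (simp add: weight_def factor_def)

lemma weight_nonneg:
  fixes x :: real
  assumes "\<And>e. 0 \<le> b e" "\<And>e. b e \<le> 1"
  shows "0 \<le> weight b x"
  using weight_LIMSEQ[OF assms, where x = x] by (rule LIMSEQ_le_const) (auto intro!: prod_nonneg factor_nonneg assms)

text \<open>A product convergent in the sense of \<open>has_prod\<close> vanishes only through one
  of its factors; mere convergence of the partial products would not exclude a limit 0.\<close>

lemma weight_eq_0_iff:
  fixes x :: real
  assumes "\<And>e. 0 \<le> b e" "\<And>e. b e \<le> 1"
  shows "weight b x = 0 \<longleftrightarrow> (\<exists>e. x = 2 ^ (e + 2) \<and> b e = 0)"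
proof -
  have "(\<lambda>e. factor (b e) e x) has_prod weight b x"
    unfolding weight_def by (intro convergent_prod_has_prod convergent_prod_factor assms)
  then show ?thesis
    using has_prod_eq_0_iff factor_eq_0_iff[OF assms(1)] by fastforce
qed

lemma holomorphic_weight:
  assumes "\<And>e. 0 \<le> b e" "\<And>e. b e \<le> 1"
  shows "(weight b :: complex \<Rightarrow> complex) holomorphic_on UNIV"
proof (rule holomorphic_uniform_sequence)
  fix z :: complex
  define R where "R = norm z + 1"
  have "uniformly_convergent_on (cball z 1) (\<lambda>N z. \<Prod>n<N. factor (b n) n z)"
  proof (rule uniformly_convergent_on_prod')
    show "uniformly_convergent_on (cball z 1) (\<lambda>N z. \<Sum>n<N. norm (factor (b n) n z - 1))"
    proof (rule Weierstrass_m_test'[OF _ summable_const_div_power])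
      fix n and w :: complex
      assume "w \<in> cball z 1"
      then have "norm w \<le> R"
        using norm_triangle_sub[of w z] by (simp add: R_def dist_norm norm_minus_commute)
      then show "norm (norm (factor (b n) n w - 1)) \<le> (R + R\<^sup>2) / 2 ^ n"
        using norm_factor_minus_1[of "b n" w R n] assms by simp
    qed
  qed (auto simp: factor_def intro!: continuous_intros)
  then obtain g where g: "uniform_limit (cball z 1) (\<lambda>N z. \<Prod>n<N. factor (b n) n z) g sequentially"
    by (auto simp: uniformly_convergent_on_def)
  have "g w = weight b w" if "w \<in> cball z 1" for w
    by (rule LIMSEQ_unique[OF tendsto_uniform_limitI[OF g that] weight_LIMSEQ[OF assms]])
  then have "uniform_limit (cball z 1) (\<lambda>N z. \<Prod>n<N. factor (b n) n z) (weight b) sequentially"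
    using g by (simp add: uniform_limit_iff)
  then show "\<exists>d>0. cball z d \<subseteq> UNIV \<and>
    uniform_limit (cball z d) (\<lambda>N z. \<Prod>n<N. factor (b n) n z) (weight b) sequentially"
    by (intro exI[of _ 1]) auto
qed (auto simp: factor_def intro!: holomorphic_intros)

text \<open>Exchange the factors one at a time. \<open>1 \<le> h i\<close> allows the missing factor
  to be put back into the bound.\<close>

lemma prod_diff_bound:
  fixes f g h :: "'i \<Rightarrow> real"
  assumes "finite I" "\<And>i. i \<in> I \<Longrightarrow> \<bar>f i\<bar> \<le> h i" "\<And>i. i \<in> I \<Longrightarrow> \<bar>g i\<bar> \<le> h i" "\<And>i. i \<in> I \<Longrightarrow> 1 \<le> h i"
  shows "\<bar>prod f I - prod g I\<bar> \<le> (\<Sum>i\<in>I. \<bar>f i - g i\<bar>) * prod h I"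
  using assms
proof (induction I rule: finite_induct)
  case (insert a I)
  let ?H = "prod h I" and ?S = "\<Sum>i\<in>I. \<bar>f i - g i\<bar>"
  have H: "\<bar>prod f I\<bar> \<le> ?H" unfolding abs_prod by (rule prod_mono) (use insert.prems(1) in auto)
  have S: "0 \<le> ?S" by (intro sum_nonneg) simp
  have h: "1 \<le> h a" "\<bar>g a\<bar> \<le> h a" "0 \<le> h a"
    using insert.prems(2,3)[of a] by auto
  have "f a * prod f I - g a * prod g I = (f a - g a) * prod f I + g a * (prod f I - prod g I)"
    by (simp add: algebra_simps)
  then have "\<bar>f a * prod f I - g a * prod g I\<bar> \<le> \<bar>f a - g a\<bar> * \<bar>prod f I\<bar> + \<bar>g a\<bar> * \<bar>prod f I - prod g I\<bar>"
    using abs_triangle_ineq[of "(f a - g a) * prod f I" "g a * (prod f I - prod g I)"] by (simp add: abs_mult)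
  also have "\<dots> \<le> \<bar>f a - g a\<bar> * ?H + h a * (?S * ?H)"
    using insert H h by (intro add_mono mult_mono) auto
  also have "\<dots> \<le> \<bar>f a - g a\<bar> * (h a * ?H) + h a * (?S * ?H)"
    using mult_right_mono[OF h(1), of ?H] order_trans[OF abs_ge_zero H]
    by (intro add_right_mono mult_left_mono) auto
  finally show ?case using insert.hyps by (simp add: algebra_simps)
qed simp

text \<open>An exponential bound turns the product of the bounds into a geometric sum in the
  exponent. With \<open>t = X / 2 ^ (e + 2)\<close> the factor is at most
  \<open>(1 + 2 * t)^2\<close>, hence at most \<open>exp (4 * t)\<close>.\<close>

lemma abs_factor_le:
  fixes x :: real
  assumes "0 \<le> \<beta>" "\<beta> \<le> 1" "\<bar>x\<bar> \<le> X"
  shows "\<bar>factor \<beta> e x\<bar> \<le> exp (X / 2 ^ e)"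
proof -
  define t where "t = X / 2 ^ (e + 2)"
  define y where "y = x / 2 ^ (e + 2)"
  have y: "\<bar>y\<bar> \<le> t" using assms(3) by (simp add: y_def t_def divide_right_mono)
  then have "(1 - y)\<^sup>2 \<le> (1 + t)\<^sup>2" "y\<^sup>2 \<le> t\<^sup>2" and t: "0 \<le> t"
    by (auto intro!: abs_le_square_iff[THEN iffD1])
  moreover have "\<beta> * y\<^sup>2 \<le> 1 * y\<^sup>2" using assms(2) by (intro mult_right_mono) auto
  ultimately have "factor \<beta> e x \<le> (1 + t)\<^sup>2 + t\<^sup>2"
    unfolding factor_def y_def[symmetric] by simp
  also have "\<dots> \<le> (1 + 2 * t)\<^sup>2" using t by (simp add: power2_eq_square algebra_simps)
  also have "\<dots> \<le> (exp (2 * t))\<^sup>2" using t by (intro power_mono exp_ge_add_one_self) auto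
  also have "\<dots> = exp (X / 2 ^ e)" by (simp add: t_def exp_double[symmetric])
  finally show ?thesis using factor_nonneg[OF assms(1), of e x] by simp
qed

lemma sum_div_power_le: "(\<Sum>e<n. 1 / 2 ^ e) \<le> (2 :: real)"
proof -
  have "(\<Sum>e<n. 1 / 2 ^ e) = 2 - 2 / (2 :: real) ^ n" by (induction n) (auto simp: field_simps)
  then show ?thesis by simp
qed

lemma prod_exp_le:
  fixes X :: real
  assumes "0 \<le> X"
  shows "(\<Prod>e<n. exp (X / 2 ^ e)) \<le> exp (2 * X)"
proof -
  have "(\<Prod>e<n. exp (X / 2 ^ e)) = exp (X * (\<Sum>e<n. 1 / 2 ^ e))"
    by (simp add: exp_sum sum_distrib_left)
  also have "\<dots> \<le> exp (X * 2)" using assms sum_div_power_le by (intro exp_mono mult_left_mono)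
  finally show ?thesis by (simp add: mult.commute)
qed

lemma abs_weight_le:
  fixes x :: real
  assumes "\<And>e. 0 \<le> b e" "\<And>e. b e \<le> 1" "\<bar>x\<bar> \<le> X"
  shows "\<bar>weight b x\<bar> \<le> exp (2 * X)"
proof (rule LIMSEQ_le_const2[OF tendsto_rabs[OF weight_LIMSEQ[OF assms(1,2)]]], intro exI allI impI)
  fix n
  have "\<bar>\<Prod>e<n. factor (b e) e x\<bar> \<le> (\<Prod>e<n. exp (X / 2 ^ e))"
    unfolding abs_prod by (intro prod_mono) (auto intro: abs_factor_le assms)
  also have "\<dots> \<le> exp (2 * X)" using assms(3) by (intro prod_exp_le) auto
  finally show "\<bar>\<Prod>e<n. factor (b e) e x\<bar> \<le> exp (2 * X)" .
qed

lemma factor_diff_le: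
  fixes x y :: real
  assumes "0 \<le> \<beta>" "\<beta> \<le> 1" "\<bar>\<beta> - \<gamma>\<bar> \<le> \<delta>" "\<bar>x\<bar> \<le> X" "\<bar>y\<bar> \<le> X" "\<bar>x - y\<bar> \<le> \<delta>" "1 \<le> X"
  shows "\<bar>factor \<beta> e x - factor \<gamma> e y\<bar> \<le> 2 * X\<^sup>2 * \<delta> / 2 ^ e"
proof -
  define l :: real where "l = 1 / 2 ^ (e + 2)"
  have l: "0 < l" "l \<le> 1" using one_le_power[of "2 :: real" "e + 2"] by (simp_all add: l_def)
  have \<delta>: "0 \<le> \<delta>" using assms(3) by simp
  have eq: "factor \<beta> e x - factor \<gamma> e y =
      l * ((x - y) * (l * (1 + \<beta>) * (x + y) - 2) + l * (\<beta> - \<gamma>) * y\<^sup>2)"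
    by (simp add: factor_def l_def power2_eq_square algebra_simps add_divide_distrib diff_divide_distrib)
  have "\<bar>l * (1 + \<beta>) * (x + y)\<bar> \<le> 1 * 2 * (2 * X)"
    unfolding abs_mult using l assms by (intro mult_mono) auto
  then have a: "\<bar>l * (1 + \<beta>) * (x + y) - 2\<bar> \<le> 4 * X + 2" by linarith
  have y: "y\<^sup>2 \<le> X\<^sup>2" using assms(5,7) by (intro abs_le_square_iff[THEN iffD1]) auto
  have "\<bar>(x - y) * (l * (1 + \<beta>) * (x + y) - 2)\<bar> \<le> \<delta> * (4 * X + 2)"
    unfolding abs_mult using a \<delta> assms(6) by (intro mult_mono) auto
  moreover have "\<bar>l * (\<beta> - \<gamma>) * y\<^sup>2\<bar> \<le> 1 * \<delta> * X\<^sup>2"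
    unfolding abs_mult using l \<delta> assms(3) y by (intro mult_mono) auto
  ultimately have "\<bar>(x - y) * (l * (1 + \<beta>) * (x + y) - 2) + l * (\<beta> - \<gamma>) * y\<^sup>2\<bar> \<le> \<delta> * (4 * X + 2) + \<delta> * X\<^sup>2"
    by linarith
  also have "\<dots> = \<delta> * (4 * X + 2 + X\<^sup>2)" by (simp add: algebra_simps)
  also have "\<dots> \<le> \<delta> * (8 * X\<^sup>2)"
  proof (rule mult_left_mono[OF _ \<delta>])
    have "X \<le> X * X" "1 \<le> X * X" using assms(7) mult_mono[of 1 X 1 X] by auto
    then show "4 * X + 2 + X\<^sup>2 \<le> 8 * X\<^sup>2" unfolding power2_eq_square by linarith
  qed
  finally have "\<bar>factor \<beta> e x - factor \<gamma> e y\<bar> \<le> l * (\<delta> * (8 * X\<^sup>2))"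
    unfolding eq abs_mult using l by (simp add: mult_left_mono)
  then show ?thesis by (simp add: l_def field_simps)
qed

text \<open>One number \<open>m\<close> controls the cut-off, the precision of the coefficients and
  that of the argument. The first \<open>m\<close> factors and the tail each contribute at most
  \<open>4 * X^2 / 2 ^ m\<close> to the sum of differences.\<close>

lemma weight_approx:
  fixes x y :: real
  assumes b: "\<And>e. 0 \<le> b e" "\<And>e. b e \<le> 1" and c: "\<And>e. 0 \<le> c e" "\<And>e. c e \<le> 1"
    and "\<And>e. \<bar>b e - c e\<bar> \<le> 1 / 2 ^ m" and X: "\<bar>x\<bar> \<le> X" "\<bar>y\<bar> \<le> X" "1 \<le> X" and "\<bar>x - y\<bar> \<le> 1 / 2 ^ m"
  shows "\<bar>weight b x - (\<Prod>e<m. factor (c e) e y)\<bar> \<le> 8 * X\<^sup>2 * exp (2 * X) / 2 ^ m"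
proof (rule LIMSEQ_le_const2[OF tendsto_rabs[OF tendsto_diff[OF weight_LIMSEQ[OF b] tendsto_const]]],
    intro exI[of _ m] allI impI)
  fix n assume n: "m \<le> n"
  \<comment> \<open>Padding with ones makes both products run over the same indices.\<close>
  define g where "g e = (if e < m then factor (c e) e y else 1)" for e
  define d :: "nat \<Rightarrow> real" where "d e = 2 * X\<^sup>2 * (if e < m then 1 / 2 ^ e / 2 ^ m else 1 / 2 ^ e)" for e
  have "(\<Prod>e<m. factor (c e) e y) = (\<Prod>e<n. g e)"
    by (rule prod.mono_neutral_cong_left) (use n in \<open>auto simp: g_def\<close>)
  moreover have "\<bar>(\<Prod>e<n. factor (b e) e x) - (\<Prod>e<n. g e)\<bar>
      \<le> (\<Sum>e<n. \<bar>factor (b e) e x - g e\<bar>) * (\<Prod>e<n. exp (X / 2 ^ e))"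
    using X by (intro prod_diff_bound) (auto simp: g_def intro: abs_factor_le b c)
  also have "\<dots> \<le> (\<Sum>e<n. d e) * exp (2 * X)"
  proof (intro mult_mono sum_mono prod_exp_le)
    fix e
    have "norm (factor (b e) e x - 1) \<le> (X + X\<^sup>2) / 2 ^ e"
      using X by (intro norm_factor_minus_1 b) auto
    also have "X + X\<^sup>2 \<le> 2 * X\<^sup>2" using X(3) by (simp add: power2_eq_square mult_left_mono[of 1 X X, simplified])
    finally have "\<bar>factor (b e) e x - 1\<bar> \<le> 2 * X\<^sup>2 / 2 ^ e" by (simp add: divide_right_mono)
    then show "\<bar>factor (b e) e x - g e\<bar> \<le> d e"
      using factor_diff_le[OF b assms(5) X(1,2) assms(9) X(3), of e]
      by (auto simp: g_def d_def field_simps)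
  qed (use X in \<open>auto intro!: sum_nonneg prod_nonneg simp: d_def\<close>)
  also have "(\<Sum>e<n. d e) \<le> 8 * X\<^sup>2 / 2 ^ m"
  proof -
    obtain k where k: "n = m + k" using n le_Suc_ex by blast
    have "(\<Sum>e<m + k. d e) = (\<Sum>e<m. d e) + (\<Sum>e<k. d (m + e))"
      by (induction k) (simp_all add: add.assoc)
    also have "(\<Sum>e<m. d e) = 2 * X\<^sup>2 / 2 ^ m * (\<Sum>e<m. 1 / 2 ^ e)"
      by (simp add: d_def sum_distrib_left field_simps)
    also have "(\<Sum>e<k. d (m + e)) = 2 * X\<^sup>2 / 2 ^ m * (\<Sum>e<k. 1 / 2 ^ e)"
      by (simp add: d_def sum_distrib_left power_add field_simps)
    also have "2 * X\<^sup>2 / 2 ^ m * (\<Sum>e<m. 1 / 2 ^ e) + 2 * X\<^sup>2 / 2 ^ m * (\<Sum>e<k. 1 / 2 ^ e) \<le>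
        2 * X\<^sup>2 / 2 ^ m * 2 + 2 * X\<^sup>2 / 2 ^ m * 2"
      by (intro add_mono mult_left_mono sum_div_power_le) auto
    finally show ?thesis unfolding k by simp
  qed
  finally show "\<bar>(\<Prod>e<n. factor (b e) e x) - (\<Prod>e<m. factor (c e) e y)\<bar> \<le> 8 * X\<^sup>2 * exp (2 * X) / 2 ^ m"
    by (simp add: mult_right_mono)
qed

section \<open>The system\<close>

text \<open>The doubling formula of the hyperbolic tangent:
  \<open>rot (tanh a) = tanh (2 * a)\<close>.\<close>

definition rot :: "'a :: field \<Rightarrow> 'a" where
  "rot u = 2 * u / (1 + u\<^sup>2)"

lemma one_add_square_pos: "0 < 1 + u\<^sup>2" for u :: real
  by (simp add: add_pos_nonneg)

lemma abs_rot_le: "\<bar>rot u\<bar> \<le> 1" for u :: real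
proof -
  have "0 \<le> (1 - u)\<^sup>2" "0 \<le> (1 + u)\<^sup>2" by simp_all
  then have "\<bar>2 * u\<bar> \<le> 1 + u\<^sup>2" by (simp add: power2_eq_square algebra_simps abs_le_iff)
  then show ?thesis using one_add_square_pos[of u] by (simp add: rot_def abs_divide)
qed

lemma rot_diff_le: "\<bar>rot u - rot w\<bar> \<le> 2 * \<bar>u - w\<bar>" for u w :: real
proof -
  define D where "D = (1 + u\<^sup>2) * (1 + w\<^sup>2)"
  have D: "1 \<le> D" using mult_mono[of 1 "1 + u\<^sup>2" 1 "1 + w\<^sup>2"] by (simp add: D_def)
  \<comment> \<open>Because \<open>D = (1 - u * w)^2 + (u + w)^2\<close>.\<close>
  have "(1 - u * w)\<^sup>2 \<le> D"
    using zero_le_power2[of "u + w"] by (simp add: D_def power2_eq_square algebra_simps)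
  also have "\<dots> \<le> D\<^sup>2" using D by (intro self_le_power) auto
  finally have "\<bar>1 - u * w\<bar> \<le> D" using D by (simp add: abs_le_square_iff[symmetric])
  then have le: "\<bar>1 - u * w\<bar> / \<bar>D\<bar> \<le> 1" using D by simp
  have eq: "rot u - rot w = 2 * (u - w) * ((1 - u * w) / D)"
    using one_add_square_pos[of u] one_add_square_pos[of w]
    by (simp add: rot_def D_def field_simps power2_eq_square)
  have "\<bar>rot u - rot w\<bar> = 2 * \<bar>u - w\<bar> * (\<bar>1 - u * w\<bar> / \<bar>D\<bar>)"
    by (simp only: eq abs_mult abs_divide abs_numeral)
  also have "\<dots> \<le> 2 * \<bar>u - w\<bar> * 1" using le by (intro mult_left_mono) auto
  finally show ?thesis by simp
qed

lemma rot_sign: "rot u \<le> 0 \<longleftrightarrow> u \<le> 0" for u :: real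
  using one_add_square_pos[of u] by (simp add: rot_def divide_le_0_iff)

lemma funpow_rot_nonpos: "u \<le> 0 \<Longrightarrow> (rot ^^ k) u \<le> 0" for u :: real
  by (induction k) (auto simp: rot_sign)

text \<open>One step leads to some \<open>c\<close> in \<open>(0, 1]\<close>. From there
  \<open>1 - rot y = (1 - y)^2 / (1 + y^2) \<le> (1 - y) * (1 - c)\<close>, so the distance to 1
  decays geometrically.\<close>

lemma rot_LIMSEQ:
  fixes u :: real
  assumes "0 < u"
  shows "(\<lambda>k. (rot ^^ k) u) \<longlonglongrightarrow> 1"
proof -
  define c where "c = rot u"
  have c: "0 < c" "c \<le> 1" using assms rot_sign[of u] abs_rot_le[of u] by (auto simp: c_def)
  have "c \<le> (rot ^^ k) c \<and> (rot ^^ k) c \<le> 1 \<and> 1 - (rot ^^ k) c \<le> (1 - c) ^ k" for k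
  proof (induction k)
    case (Suc k)
    define y where "y = (rot ^^ k) c"
    have y: "c \<le> y" "y \<le> 1" "1 - y \<le> (1 - c) ^ k" using Suc by (auto simp: y_def)
    have eq: "1 - rot y = (1 - y) * ((1 - y) / (1 + y\<^sup>2))"
      using one_add_square_pos[of y] by (simp add: rot_def field_simps power2_eq_square)
    have "(1 - y) / (1 + y\<^sup>2) \<le> (1 - y) / 1" using y by (intro divide_left_mono) (auto simp: one_add_square_pos)
    then have le: "(1 - y) / (1 + y\<^sup>2) \<le> 1 - c" using y by simp
    have "1 - rot y \<le> (1 - c) ^ k * (1 - c)"
      unfolding eq using y c le by (intro mult_mono) (auto simp: one_add_square_pos less_imp_le)
    moreover have "1 - rot y \<le> (1 - y) * 1"
      unfolding eq using y c le by (intro mult_left_mono) auto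
    ultimately show ?case using y abs_rot_le[of y] by (simp add: y_def abs_le_iff mult.commute)
  qed (use c in auto)
  then have "\<forall>k. norm ((rot ^^ k) c - 1) \<le> (1 - c) ^ k"
    by (simp add: abs_le_iff)
  then have "(\<lambda>k. (rot ^^ k) c - 1) \<longlonglongrightarrow> 0"
    by (rule Lim_null_comparison[OF always_eventually]) (use c in \<open>intro LIMSEQ_realpow_zero; simp\<close>)
  then have "(\<lambda>k. (rot ^^ k) c) \<longlonglongrightarrow> 1" by (rule LIM_zero_cancel)
  then have "(\<lambda>k. (rot ^^ Suc k) u) \<longlonglongrightarrow> 1" by (simp add: c_def funpow_Suc_right del: funpow.simps)
  then show ?thesis by (rule LIMSEQ_imp_Suc)
qed

section \<open>The coefficients and their rational approximations\<close>

definition bits :: "nat \<Rightarrow> real" where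
  "bits e = (\<Sum>t. of_bool (accepts e t) / 2 ^ (t + 1))"

lemma half_sums: "(\<lambda>t. 1 / 2 ^ (t + 1) :: real) sums 1"
  using power_half_series by (simp add: power_divide)

lemma summable_bits: "summable (\<lambda>t. of_bool (accepts e t) / 2 ^ (t + 1) :: real)"
  by (rule summable_comparison_test'[OF sums_summable[OF half_sums], of 0]) auto

lemma bits_nonneg: "0 \<le> bits e"
  unfolding bits_def by (intro suminf_nonneg summable_bits) auto

lemma bits_le_1: "bits e \<le> 1"
proof -
  have "bits e \<le> (\<Sum>t. 1 / 2 ^ (t + 1))"
    unfolding bits_def by (intro suminf_le summable_bits sums_summable[OF half_sums]) auto
  then show ?thesis using half_sums by (simp add: sums_iff)
qed

lemma bits_eq_0_iff: "bits e = 0 \<longleftrightarrow> \<not> (\<exists>t. accepts e t)"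
  unfolding bits_def by (subst suminf_eq_zero_iff[OF summable_bits]) auto

definition bits_num :: "nat \<Rightarrow> nat \<Rightarrow> nat" where
  "bits_num e m = rec_nat 0 (\<lambda>t r. 2 * r + of_bool (accepts e t)) m"

lemma pr_bits_num: "pr A \<Longrightarrow> pr B \<Longrightarrow> pr (\<lambda>v. bits_num (A v) (B v))"
  by (erule (1) pr_app2[rotated]) (unfold bits_num_def, intro pr_rec pr_accepts pr_add pr_mult pr_const pr.Var)

lemma bits_num_eq: "real (bits_num e m) / 2 ^ m = (\<Sum>t<m. of_bool (accepts e t) / 2 ^ (t + 1))"
  by (induction m) (auto simp: bits_num_def field_simps)

lemma bits_approx:
  shows "0 \<le> real (bits_num e m) / 2 ^ m" "real (bits_num e m) / 2 ^ m \<le> 1"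
    and "\<bar>bits e - real (bits_num e m) / 2 ^ m\<bar> \<le> 1 / 2 ^ m"
proof -
  let ?f = "\<lambda>t. of_bool (accepts e t) / 2 ^ (t + 1) :: real"
  have split: "bits e = (\<Sum>t. ?f (t + m)) + real (bits_num e m) / 2 ^ m"
    unfolding bits_def bits_num_eq by (rule suminf_split_initial_segment[OF summable_bits])
  have s: "summable (\<lambda>t. ?f (t + m))" using summable_bits by (rule summable_ignore_initial_segment)
  have h: "(\<lambda>t. 1 / 2 ^ (t + 1) * (1 / 2 ^ m) :: real) sums (1 * (1 / 2 ^ m))"
    by (intro sums_mult2 half_sums)
  have "(\<Sum>t. ?f (t + m)) \<le> (\<Sum>t. 1 / 2 ^ (t + 1) * (1 / 2 ^ m))"
    by (intro suminf_le s sums_summable[OF h]) (auto simp: power_add)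
  then have "(\<Sum>t. ?f (t + m)) \<le> 1 / 2 ^ m" using h by (simp add: sums_iff)
  moreover have "0 \<le> (\<Sum>t. ?f (t + m))" by (intro suminf_nonneg s) auto
  ultimately show "\<bar>bits e - real (bits_num e m) / 2 ^ m\<bar> \<le> 1 / 2 ^ m" "real (bits_num e m) / 2 ^ m \<le> 1"
    using split bits_le_1[of e] by linarith+
qed simp

definition system :: "real vec \<Rightarrow> real vec" where
  "system v = vec 2 (\<lambda>i. if i = 0 then 0 else rot (v $ 1) * weight bits (v $ 0))"

subsection \<open>Computability\<close>

text \<open>The absolute value of \<open>a - (-1) ^ s * p\<close>, written with truncated
  subtraction; only its square is used.\<close>

definition gap :: "nat \<Rightarrow> nat \<Rightarrow> nat \<Rightarrow> nat" where
  "gap s a p = (if s = 0 then (a - p) + (p - a) else a + p)"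

lemma gap: "s \<le> 1 \<Longrightarrow> (real (gap s a p))\<^sup>2 = (real a - (-1) ^ s * real p)\<^sup>2"
  by (cases "a \<le> p"; cases s) (auto simp: gap_def of_nat_diff power2_commute)

lemma pr_gap: "pr A \<Longrightarrow> pr B \<Longrightarrow> pr C \<Longrightarrow> pr (\<lambda>v. gap (A v) (B v) (C v))"
  unfolding gap_def by (intro pr_arith)

text \<open>
  The variables 4 to 6 hold sign, numerator and denominator of the first coordinate, 7 to 9 those of
  the second one, and 10 holds the precision.
\<close>

definition weight_num :: "(nat \<Rightarrow> nat) \<Rightarrow> nat" where
  "weight_num v = rec_nat 1 (\<lambda>e r. r * ((gap (v 4) (2 ^ (e + 2) * v 6) (v 5)) ^ 2 * 2 ^ v 10 +
     bits_num e (v 10) * v 5 ^ 2)) (v 10)"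

definition weight_den :: "(nat \<Rightarrow> nat) \<Rightarrow> nat" where
  "weight_den v = rec_nat 1 (\<lambda>e r. r * ((2 ^ (e + 2) * v 6) ^ 2 * 2 ^ v 10)) (v 10)"

definition system_num :: "(nat \<Rightarrow> nat) \<Rightarrow> nat" where
  "system_num v = 2 * v 8 * v 9 * weight_num v"

definition system_den :: "(nat \<Rightarrow> nat) \<Rightarrow> nat" where
  "system_den v = (v 8 ^ 2 + v 9 ^ 2) * weight_den v"

text \<open>The weight is never negative, so the sign is that of the second coordinate; a zero must
  stay unsigned.\<close>

definition system_sign :: "(nat \<Rightarrow> nat) \<Rightarrow> nat" where
  "system_sign v = of_bool (v 7 \<noteq> 0 \<and> system_num v \<noteq> 0)"

lemma pr_weight: "pr weight_num" "pr weight_den"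
  unfolding weight_num_def[abs_def] weight_den_def[abs_def]
  by (intro pr_rec pr_gap pr_bits_num pr_arith)+

lemma pr_system: "pr system_num" "pr system_den" "pr system_sign"
proof -
  show num: "pr system_num"
    unfolding system_num_def[abs_def] by (intro pr_weight(1) pr_arith)
  show "pr system_den"
    unfolding system_den_def[abs_def] by (intro pr_weight(2) pr_arith)
  show "pr system_sign"
    unfolding system_sign_def[abs_def] by (intro num pr_arith)
qed

text \<open>Each factor is brought over the denominator \<open>(2 ^ (e + 2) * d)^2 * 2 ^ m\<close>
  without cancelling; the sign of the argument survives only inside \<open>gap\<close>.\<close>

lemma weight_quotient:
  assumes "v 4 \<le> 1" "0 < v 6"
  shows "real (weight_num v) / real (weight_den v) =
    (\<Prod>e<v 10. factor (real (bits_num e (v 10)) / 2 ^ v 10) e ((-1) ^ v 4 * real (v 5) / real (v 6)))"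
    and "0 < weight_den v"
proof -
  define m where "m = v 10"
  define \<sigma> :: real where "\<sigma> = (-1) ^ v 4"
  define p d where "p = real (v 5)" and "d = real (v 6)"
  have d: "0 < d" using assms(2) by (simp add: d_def)
  have \<sigma>: "\<sigma>\<^sup>2 = 1" by (simp add: \<sigma>_def flip: power_mult)
  have factor: "((2 ^ (e + 2) * d - \<sigma> * p)\<^sup>2 * 2 ^ m + B * p\<^sup>2) / ((2 ^ (e + 2) * d)\<^sup>2 * 2 ^ m)
    = factor (B / 2 ^ m) e (\<sigma> * p / d)" for e B
  proof -
    define a where "a = 2 ^ (e + 2) * d"
    have a: "a \<noteq> 0" using d by (simp add: a_def)
    have "((a - \<sigma> * p)\<^sup>2 * 2 ^ m + B * p\<^sup>2) / (a\<^sup>2 * 2 ^ m) = ((a - \<sigma> * p) / a)\<^sup>2 + B / 2 ^ m * (p / a)\<^sup>2"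
      using a by (simp add: power_divide add_divide_distrib)
    also have "(a - \<sigma> * p) / a = 1 - \<sigma> * p / a" using a by (simp add: diff_divide_distrib)
    also have "(p / a)\<^sup>2 = (\<sigma> * p / a)\<^sup>2" using \<sigma> by (simp add: power_mult_distrib power_divide)
    also have "\<sigma> * p / a = \<sigma> * p / d / 2 ^ (e + 2)" by (simp add: a_def)
    finally show ?thesis by (simp add: factor_def a_def)
  qed
  define N D where "N k = rec_nat 1 (\<lambda>e r. r * ((gap (v 4) (2 ^ (e + 2) * v 6) (v 5)) ^ 2 * 2 ^ m +
     bits_num e m * v 5 ^ 2)) k" and "D k = rec_nat 1 (\<lambda>e r. r * ((2 ^ (e + 2) * v 6) ^ 2 * 2 ^ m)) k" for k
  have D: "0 < D k" for k using assms(2) by (induction k) (auto simp: D_def)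
  have "real (N k) / real (D k) = (\<Prod>e<k. factor (real (bits_num e m) / 2 ^ m) e (\<sigma> * p / d))" for k
  proof (induction k)
    case (Suc k)
    have "real (N (Suc k)) / real (D (Suc k)) = real (N k) / real (D k) *
      (((2 ^ (k + 2) * d - \<sigma> * p)\<^sup>2 * 2 ^ m + real (bits_num k m) * p\<^sup>2) / ((2 ^ (k + 2) * d)\<^sup>2 * 2 ^ m))"
      by (simp add: N_def D_def gap[OF assms(1)] p_def d_def \<sigma>_def)
    then show ?case by (simp only: Suc factor prod.lessThan_Suc)
  qed (simp add: N_def D_def)
  then show "real (weight_num v) / real (weight_den v) =
    (\<Prod>e<v 10. factor (real (bits_num e (v 10)) / 2 ^ v 10) e ((-1) ^ v 4 * real (v 5) / real (v 6)))"
    by (simp add: N_def D_def weight_num_def weight_den_def m_def p_def d_def \<sigma>_def)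
  show "0 < weight_den v" using D[of m] by (simp add: weight_den_def D_def m_def)
qed

lemma system_quotient:
  assumes "v 4 \<le> 1" "0 < v 6" "v 7 \<le> 1" "0 < v 9"
  shows "(-1) ^ system_sign v * real (system_num v) / real (system_den v) =
    rot ((-1) ^ v 7 * real (v 8) / real (v 9)) *
    (\<Prod>e<v 10. factor (real (bits_num e (v 10)) / 2 ^ v 10) e ((-1) ^ v 4 * real (v 5) / real (v 6)))"
proof -
  define \<sigma> :: real where "\<sigma> = (-1) ^ v 7"
  have \<sigma>: "\<sigma>\<^sup>2 = 1" by (simp add: \<sigma>_def flip: power_mult)
  define p d where "p = real (v 8)" and "d = real (v 9)"
  have d: "0 < d" using assms(4) by (simp add: d_def)
  have "rot (\<sigma> * p / d) = \<sigma> * (2 * p * d / (p\<^sup>2 + d\<^sup>2))"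
  proof -
    have "rot (\<sigma> * p / d) = 2 * (\<sigma> * p / d) / (1 + p\<^sup>2 / d\<^sup>2)"
      using \<sigma> by (simp add: rot_def power_divide power_mult_distrib)
    also have "\<dots> = \<sigma> * (2 * p * d / (p\<^sup>2 + d\<^sup>2))"
      using d by (simp add: field_simps power2_eq_square)
    finally show ?thesis .
  qed
  moreover have "(-1) ^ system_sign v * real (system_num v) = \<sigma> * real (system_num v)"
    using assms(3) by (cases "v 7") (auto simp: system_sign_def \<sigma>_def)
  ultimately show ?thesis
    unfolding weight_quotient(1)[OF assms(1,2), symmetric]
    by (simp add: system_num_def system_den_def p_def d_def \<sigma>_def)
qed

lemma quotient_of_sign:
  assumes "quotient_of r = (a, b)"
  shows "(-1) ^ of_bool (a < 0) * real (nat \<bar>a\<bar>) / real (nat b) = of_rat r" "0 < b"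
proof -
  show b: "0 < b" using quotient_of_denom_pos[OF assms] .
  have "of_rat r = (of_int a / of_int b :: real)"
    using quotient_of_div[OF assms] by (simp add: of_rat_divide)
  then show "(-1) ^ of_bool (a < 0) * real (nat \<bar>a\<bar>) / real (nat b) = of_rat r"
    using b by simp
qed

text \<open>The error is at most \<open>(2 + 8 * N^2) * exp (2 * N) / 2 ^ m\<close>. By
  \<open>N \<le> 2 ^ N\<close> and \<open>exp 1 \<le> 4\<close> the numerator is at most
  \<open>10 * 4 ^ N * 16 ^ N\<close>, and \<open>m = k + 6 * N + 4\<close> gives
  \<open>2 ^ m = 2 ^ k * 4 ^ N * 16 ^ N * 16\<close>.\<close>

lemma system_estimate:
  fixes x y u w :: real
  assumes "\<bar>x\<bar> \<le> real N" "\<bar>y\<bar> \<le> real N" "1 \<le> N" "m = k + 6 * N + 4" "\<bar>x - y\<bar> \<le> 1 / 2 ^ m" "\<bar>u - w\<bar> \<le> 1 / 2 ^ m"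
  shows "\<bar>rot w * (\<Prod>e<m. factor (real (bits_num e m) / 2 ^ m) e y) - rot u * weight bits x\<bar> < 1 / 2 ^ k"
proof -
  define A where "A = (\<Prod>e<m. factor (real (bits_num e m) / 2 ^ m) e y)"
  let ?W = "weight bits x" and ?X = "real N"
  have X: "1 \<le> ?X" using assms(3) by simp
  have W: "\<bar>?W\<bar> \<le> exp (2 * ?X)" by (rule abs_weight_le[OF bits_nonneg bits_le_1 assms(1)])
  have A: "\<bar>?W - A\<bar> \<le> 8 * ?X\<^sup>2 * exp (2 * ?X) / 2 ^ m"
    unfolding A_def
    by (rule weight_approx[OF bits_nonneg bits_le_1 bits_approx(1,2,3) assms(1,2) X assms(5)])
  have r: "\<bar>rot w - rot u\<bar> \<le> 2 * (1 / 2 ^ m)"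
    by (rule order_trans[OF rot_diff_le]) (use assms(6) in \<open>simp add: abs_minus_commute\<close>)
  have "rot w * A - rot u * ?W = (rot w - rot u) * ?W - rot w * (?W - A)"
    by (simp add: algebra_simps)
  then have "\<bar>rot w * A - rot u * ?W\<bar> \<le> \<bar>rot w - rot u\<bar> * \<bar>?W\<bar> + \<bar>rot w\<bar> * \<bar>?W - A\<bar>"
    using abs_triangle_ineq4[of "(rot w - rot u) * ?W" "rot w * (?W - A)"] by (simp add: abs_mult)
  also have "\<dots> \<le> (2 * (1 / 2 ^ m)) * exp (2 * ?X) + 1 * (8 * ?X\<^sup>2 * exp (2 * ?X) / 2 ^ m)"
    using r W A abs_rot_le[of w] by (intro add_mono mult_mono) auto
  also have "\<dots> = (2 + 8 * ?X\<^sup>2) * exp (2 * ?X) / 2 ^ m" by (simp add: algebra_simps add_divide_distrib)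
  also have "\<dots> \<le> (10 * 4 ^ N) * 16 ^ N / 2 ^ m"
  proof (intro divide_right_mono mult_mono)
    have "?X \<le> 2 ^ N" using of_nat_less_two_power[of N, where 'a = real] by simp
    then have "?X\<^sup>2 \<le> (2 ^ N)\<^sup>2" by (intro power_mono) auto
    also have "\<dots> = 4 ^ N" by (simp add: power2_eq_square flip: power_mult_distrib)
    finally show "2 + 8 * ?X\<^sup>2 \<le> 10 * 4 ^ N" using one_le_power[of "4 :: real" N] by linarith
    have "exp (2 * ?X) = exp 1 ^ (2 * N)" by (simp flip: exp_of_nat_mult)
    also have "\<dots> \<le> 4 ^ (2 * N)" using exp_le by (intro power_mono) auto
    finally show "exp (2 * ?X) \<le> 16 ^ N" by (simp add: power_mult)
  qed auto
  also have "\<dots> = 10 / 16 / 2 ^ k"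
  proof -
    have "(2 :: real) ^ m = 2 ^ k * 4 ^ N * 16 ^ N * 16"
      by (simp add: assms(4) power_add power_mult flip: power_mult_distrib)
    then show ?thesis by simp
  qed
  also have "\<dots> < 1 / 2 ^ k" by (simp add: field_simps)
  finally show ?thesis by (simp add: A_def)
qed

lemma computable_system: "computable_function 2 2 system"
proof (rule computable_functionI[where \<mu> = "\<lambda>k a. k + 6 * (a + 2) + 4"])
  show "pr (\<lambda>v. v 0 + 6 * (v 2 + 2) + 4)" by (intro pr_arith)
  fix x :: "real vec" and \<phi> k
  assume x: "x \<in> carrier_vec 2" and \<phi>: "is_oracle_vec 2 \<phi> x"
  show "system x $ 0 = 0" by (simp add: system_def)
  obtain a0 b0 where q0: "quotient_of (\<phi> 0 0) = (a0, b0)" by fastforce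
  \<comment> \<open>A numerator bounds its fraction. One unit is for the error of the answer at
    precision 0, the other for that of the later answer.\<close>
  define N where "N = nat \<bar>a0\<bar> + 2"
  define m where "m = k + 6 * N + 4"
  obtain a1 b1 where q1: "quotient_of (\<phi> 0 m) = (a1, b1)" by fastforce
  obtain a2 b2 where q2: "quotient_of (\<phi> 1 m) = (a2, b2)" by fastforce
  define v where "v = inputs (\<lambda>k a. k + 6 * (a + 2) + 4) \<phi> k"
  have v: "v 4 = of_bool (a1 < 0)" "v 5 = nat \<bar>a1\<bar>" "v 6 = nat b1"
    "v 7 = of_bool (a2 < 0)" "v 8 = nat \<bar>a2\<bar>" "v 9 = nat b2" "v 10 = m"
    unfolding v_def inputs_def Let_def q0 fst_conv N_def[symmetric] m_def[symmetric] q1 q2 by simp_all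
  note r1 = quotient_of_sign[OF q1] and r2 = quotient_of_sign[OF q2] and r0 = quotient_of_sign[OF q0]
  have approx: "\<bar>x $ i - real_of_rat (\<phi> i j)\<bar> \<le> 1 / 2 ^ j" if "i < 2" for i j
    using \<phi> that by (simp add: is_oracle_vec_def is_oracle_def)
  have "\<bar>real_of_rat (\<phi> 0 0)\<bar> = real (nat \<bar>a0\<bar>) / real (nat b0)"
    unfolding r0(1)[symmetric] by (simp add: abs_mult abs_divide power_abs)
  also have "\<dots> \<le> real (nat \<bar>a0\<bar>)"
    using r0(2) divide_left_mono[of 1 "real (nat b0)" "real (nat \<bar>a0\<bar>)"] by simp
  finally have "\<bar>real_of_rat (\<phi> 0 0)\<bar> \<le> real N - 2" by (simp add: N_def)
  then have x0: "\<bar>x $ 0\<bar> \<le> real N - 1"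
    using approx[OF zero_less_numeral, of 0] unfolding power_0 div_by_1 by linarith
  have "1 / 2 ^ m \<le> (1 :: real)" by simp
  then have "\<bar>of_rat (\<phi> 0 m)\<bar> \<le> real N" using x0 approx[of 0 m] by linarith
  with x0 have "\<bar>rot (of_rat (\<phi> 1 m)) * (\<Prod>e<m. factor (real (bits_num e m) / 2 ^ m) e (of_rat (\<phi> 0 m))) -
      rot (x $ 1) * weight bits (x $ 0)\<bar> < 1 / 2 ^ k"
    using approx[of 0 m] approx[of 1 m] by (intro system_estimate[where N = N]) (auto simp: m_def N_def)
  moreover have "(-1) ^ system_sign v * real (system_num v) / real (system_den v) =
      rot (of_rat (\<phi> 1 m)) * (\<Prod>e<m. factor (real (bits_num e m) / 2 ^ m) e (of_rat (\<phi> 0 m)))"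
    using r1 r2 by (subst system_quotient) (auto simp: v)
  moreover have "0 < system_den v"
    using weight_quotient(2)[of v] r1(2) r2(2) by (simp add: system_den_def v)
  moreover have "system_sign v = 0 \<or> system_sign v = 1 \<and> 0 < system_num v"
    by (auto simp: system_sign_def)
  ultimately show "0 < system_den v \<and> (system_sign v = 0 \<or> system_sign v = 1 \<and> 0 < system_num v) \<and>
      \<bar>(-1) ^ system_sign v * real (system_num v) / real (system_den v) - system x $ 1\<bar> < 1 / 2 ^ k"
    by (simp add: system_def)
qed (fact pr_system)+

subsection \<open>Analyticity\<close>

text \<open>Take real parts of the complex Taylor coefficients. Unordered summation needs absolute
  convergence, which follows from convergence at a point \<open>t\<close> strictly farther from the
  centre.\<close>

lemma real_power_series:
  assumes "F holomorphic_on ball (complex_of_real a) r"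
    and "\<And>x. \<bar>x - a\<bar> < r \<Longrightarrow> F (of_real x) = of_real (f x)"
  shows "\<exists>c. \<forall>x. \<bar>x - a\<bar> < r \<longrightarrow> ((\<lambda>n. c n * (x - a) ^ n) has_sum f x) UNIV"
proof (intro exI allI impI)
  let ?C = "\<lambda>n. (deriv ^^ n) F (of_real a) / fact n"
  have sums: "(\<lambda>n. ?C n * of_real (x - a) ^ n) sums of_real (f x)" if "\<bar>x - a\<bar> < r" for x
    using holomorphic_power_series[OF assms(1), of "of_real x"] assms(2)[OF that] that
    by (simp add: dist_norm norm_minus_commute flip: of_real_diff)
  fix x assume x: "\<bar>x - a\<bar> < r"
  then obtain t where t: "\<bar>x - a\<bar> < t" "t < r" using dense by blast
  have "summable (\<lambda>n. ?C n * of_real t ^ n)"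
    using sums[of "a + t"] t by (simp add: sums_iff)
  then have sn: "summable (\<lambda>n. norm (?C n * of_real (x - a) ^ n))"
    using t by (intro powser_insidea[of _ "of_real t"]) (auto simp flip: of_real_diff)
  have "Re (z * of_real y) = Re z * y" for z y by simp
  then have Re: "Re (?C n * of_real (x - a) ^ n) = Re (?C n) * (x - a) ^ n" for n
    by (simp only: of_real_power[symmetric])
  have le: "norm (Re (?C n) * (x - a) ^ n) \<le> norm (?C n * of_real (x - a) ^ n)" for n
    unfolding Re[symmetric] real_norm_def by (rule abs_Re_le_cmod)
  have "summable (\<lambda>n. norm (Re (?C n) * (x - a) ^ n))"
    by (rule summable_comparison_test'[OF sn, of 0]) (use le in simp)
  moreover have "(\<lambda>n. Re (?C n) * (x - a) ^ n) sums f x"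
    using sums_Re[OF sums[OF x]] unfolding Re by simp
  ultimately show "((\<lambda>n. Re (?C n) * (x - a) ^ n) has_sum f x) UNIV"
    by (rule norm_summable_imp_has_sum)
qed

lemma has_sum_product:
  fixes f :: "'a \<Rightarrow> real" and g :: "'b \<Rightarrow> real"
  assumes "(f has_sum a) A" "(g has_sum b) B"
  shows "((\<lambda>(m, n). f m * g n) has_sum (a * b)) (A \<times> B)"
proof (rule has_sum_SigmaI)
  show "((\<lambda>n. case (m, n) of (m, n) \<Rightarrow> f m * g n) has_sum (f m * b)) B" for m
    using has_sum_cmult_right[OF assms(2)] by simp
  show "((\<lambda>m. f m * b) has_sum (a * b)) A"
    by (rule has_sum_cmult_left[OF assms(1)])
  have f: "(\<lambda>m. norm (f m)) summable_on A" and g: "(\<lambda>n. norm (g n)) summable_on B"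
    using assms summable_on_iff_abs_summable_on_real has_sum_imp_summable by blast+
  have "(\<lambda>p. norm (case p of (m, n) \<Rightarrow> f m * g n)) summable_on A \<times> B"
    by (rule iffD2[OF Infinite_Sum.abs_summable_on_Sigma_iff])
      (use f g in \<open>auto simp: abs_mult infsum_cmult_right' infsum_nonneg
        intro!: summable_on_cmult_right summable_on_cmult_left\<close>)
  then show "(\<lambda>(m, n). f m * g n) summable_on A \<times> B"
    by (rule abs_summable_summable)
qed

lemma edist_2: "x \<in> carrier_vec 2 \<Longrightarrow> edist x y = sqrt ((x $ 0 - y $ 0)\<^sup>2 + (x $ 1 - y $ 1)\<^sup>2)"
  by (simp add: edist_def numeral_2_eq_2)

lemma abs_le_edist:
  assumes "x \<in> carrier_vec 2"
  shows "\<bar>x $ 0 - y $ 0\<bar> \<le> edist x y" "\<bar>x $ 1 - y $ 1\<bar> \<le> edist x y"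
  using assms by (auto simp: edist_2 intro!: real_le_rsqrt)

lemma bij_betw_vec_2: "bij_betw (\<lambda>(m, n). vec 2 (\<lambda>i. if i = 0 then m else n)) UNIV (carrier_vec 2)"
proof (rule bij_betwI[where g = "\<lambda>\<alpha>. (\<alpha> $ 0, \<alpha> $ 1)"])
  fix y :: "'a vec"
  assume "y \<in> carrier_vec 2"
  then show "(case (y $ 0, y $ 1) of (m, n) \<Rightarrow> vec 2 (\<lambda>i. if i = 0 then m else n)) = y"
    by (intro eq_vecI) (auto simp: less_Suc_eq numeral_2_eq_2)
qed auto

text \<open>The variables separate, so the coefficient of a multi-index is a product of two
  one-variable coefficients.\<close>

lemma real_analytic_product:
  assumes f: "\<And>a. \<exists>c. \<forall>x. \<bar>x - a\<bar> < 1 \<longrightarrow> ((\<lambda>n. c n * (x - a) ^ n) has_sum f x) UNIV"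
    and g: "\<And>a. \<exists>c. \<forall>x. \<bar>x - a\<bar> < 1 \<longrightarrow> ((\<lambda>n. c n * (x - a) ^ n) has_sum g x) UNIV"
  shows "real_analytic 2 2 (\<lambda>v. vec 2 (\<lambda>i. if i = 0 then 0 else f (v $ 1) * g (v $ 0)))"
  unfolding real_analytic_def
proof (intro ballI allI impI)
  fix a :: "real vec" and i :: nat
  assume a: "a \<in> carrier_vec 2" and i: "i < 2"
  obtain c d where c: "\<And>x. \<bar>x - a $ 1\<bar> < 1 \<Longrightarrow> ((\<lambda>n. c n * (x - a $ 1) ^ n) has_sum f x) UNIV"
    and d: "\<And>x. \<bar>x - a $ 0\<bar> < 1 \<Longrightarrow> ((\<lambda>n. d n * (x - a $ 0) ^ n) has_sum g x) UNIV"
    using f[of "a $ 1"] g[of "a $ 0"] by blast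
  define C where "C \<alpha> = (if i = 0 then 0 else d (\<alpha> $ 0) * c (\<alpha> $ 1))" for \<alpha> :: "nat vec"
  have "((\<lambda>\<alpha>. C \<alpha> * (\<Prod>j<2. (x $ j - a $ j) ^ (\<alpha> $ j))) has_sum
      vec 2 (\<lambda>i. if i = 0 then 0 else f (x $ 1) * g (x $ 0)) $ i) (carrier_vec 2)"
    if x: "x \<in> carrier_vec 2" "edist x a < 1" for x
  proof (cases "i = 0")
    case True
    then show ?thesis using i by (simp add: C_def)
  next
    case False
    have "((\<lambda>(m, n). (d m * (x $ 0 - a $ 0) ^ m) * (c n * (x $ 1 - a $ 1) ^ n)) has_sum g (x $ 0) * f (x $ 1)) (UNIV \<times> UNIV)"
      using abs_le_edist[OF x(1), of a] x(2) by (intro has_sum_product c d) auto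
    moreover define G where "G \<alpha> = C \<alpha> * (\<Prod>j<2. (x $ j - a $ j) ^ (\<alpha> $ j))" for \<alpha>
    have "(\<lambda>(m, n). (d m * (x $ 0 - a $ 0) ^ m) * (c n * (x $ 1 - a $ 1) ^ n)) =
      (\<lambda>p. G (case p of (m, n) \<Rightarrow> vec 2 (\<lambda>i. if i = 0 then m else n)))"
      using False by (auto simp: G_def C_def numeral_2_eq_2)
    ultimately have "((\<lambda>p. G (case p of (m, n) \<Rightarrow> vec 2 (\<lambda>i. if i = 0 then m else n))) has_sum
        g (x $ 0) * f (x $ 1)) UNIV"
      by simp
    then have "(G has_sum g (x $ 0) * f (x $ 1)) (carrier_vec 2)"
      by (rule iffD1[OF has_sum_reindex_bij_betw[OF bij_betw_vec_2, where f = G]])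
    then show ?thesis
      using False i by (simp add: G_def[abs_def] mult.commute)
  qed
  then show "\<exists>c r. r > 0 \<and> (\<forall>x\<in>carrier_vec 2. edist x a < r \<longrightarrow>
      ((\<lambda>\<alpha>. c \<alpha> * (\<Prod>j<2. (x $ j - a $ j) ^ (\<alpha> $ j))) has_sum
        vec 2 (\<lambda>i. if i = 0 then 0 else f (x $ 1) * g (x $ 0)) $ i) (carrier_vec 2))"
    by (intro exI[of _ C] exI[of _ "1 :: real"]) auto
qed

lemma real_analytic_system: "real_analytic 2 2 system"
  unfolding system_def[abs_def]
proof (rule real_analytic_product)
  fix a :: real
  have "weight bits holomorphic_on ball (complex_of_real a) 1"
    by (rule holomorphic_on_subset[OF holomorphic_weight[OF bits_nonneg bits_le_1]]) simp
  then show "\<exists>c. \<forall>x. \<bar>x - a\<bar> < 1 \<longrightarrow> ((\<lambda>n. c n * (x - a) ^ n) has_sum weight bits x) UNIV"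
    by (rule real_power_series) (simp add: weight_of_real bits_nonneg bits_le_1)
  \<comment> \<open>The poles of \<open>rot\<close> have distance at least 1 from every real point,
    so open discs of radius 1 avoid them.\<close>
  have "1 + z\<^sup>2 \<noteq> 0" if "z \<in> ball (complex_of_real a) 1" for z
  proof
    assume "1 + z\<^sup>2 = 0"
    then have "(z - \<i>) * (z + \<i>) = 0" by (simp add: power2_eq_square algebra_simps)
    then have "\<bar>Im z\<bar> = 1" by (auto simp: eq_neg_iff_add_eq_0[symmetric])
    moreover have "\<bar>Im (z - of_real a)\<bar> \<le> norm (z - of_real a)" by (rule abs_Im_le_cmod)
    ultimately show False using that by (simp add: dist_norm norm_minus_commute)
  qed
  then have "rot holomorphic_on ball (complex_of_real a) 1"
    unfolding rot_def[abs_def] by (intro holomorphic_intros) auto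
  then show "\<exists>c. \<forall>x. \<bar>x - a\<bar> < 1 \<longrightarrow> ((\<lambda>n. c n * (x - a) ^ n) has_sum rot x) UNIV"
    by (rule real_power_series) (simp add: rot_def)
qed

subsection \<open>The basin of attraction\<close>

definition rest :: "real vec" where
  "rest = vec 2 (\<lambda>i. if i = 0 then 0 else 1)"

lemma funpow_system:
  "(system ^^ Suc k) v = vec 2 (\<lambda>i. if i = 0 then 0 else (rot ^^ k) (rot (v $ 1) * weight bits (v $ 0)))"
proof (induction k)
  case (Suc k)
  show ?case unfolding funpow.simps(2)[of "Suc k"] comp_apply Suc
    by (auto simp: system_def weight_0)
qed (simp add: system_def cong: if_cong)

lemma basin_system: "basin Discrete 2 system rest = {v \<in> carrier_vec 2. 0 < v $ 1 \<and> weight bits (v $ 0) \<noteq> 0}"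
proof -
  have "(\<lambda>k. edist ((system ^^ k) v) rest) \<longlonglongrightarrow> 0 \<longleftrightarrow> 0 < v $ 1 \<and> weight bits (v $ 0) \<noteq> 0" for v
  proof -
    define y where "y = rot (v $ 1) * weight bits (v $ 0)"
    have W: "0 \<le> weight bits (v $ 0)" by (rule weight_nonneg[OF bits_nonneg bits_le_1])
    have "edist ((system ^^ Suc k) v) rest = \<bar>(rot ^^ k) y - 1\<bar>" for k
      unfolding funpow_system y_def[symmetric] by (subst edist_2) (auto simp: rest_def)
    then have "(\<lambda>k. edist ((system ^^ k) v) rest) \<longlonglongrightarrow> 0 \<longleftrightarrow> (\<lambda>k. \<bar>(rot ^^ k) y - 1\<bar>) \<longlonglongrightarrow> 0"
      using filterlim_sequentially_Suc[of "\<lambda>k. edist ((system ^^ k) v) rest"] by simp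
    also have "\<dots> \<longleftrightarrow> (\<lambda>k. (rot ^^ k) y) \<longlonglongrightarrow> 1"
      by (simp add: tendsto_rabs_zero_iff LIM_zero_iff)
    also have "\<dots> \<longleftrightarrow> 0 < y"
    proof
      assume lim: "(\<lambda>k. (rot ^^ k) y) \<longlonglongrightarrow> 1"
      show "0 < y"
      proof (rule ccontr)
        assume "\<not> 0 < y"
        then have "(1 :: real) \<le> 0"
          using funpow_rot_nonpos by (intro LIMSEQ_le_const2[OF lim]) auto
        then show False by simp
      qed
    qed (rule rot_LIMSEQ)
    also have "\<dots> \<longleftrightarrow> 0 < v $ 1 \<and> weight bits (v $ 0) \<noteq> 0"
      using W rot_sign[of "v $ 1"] by (auto simp: y_def zero_less_mult_iff)
    finally show ?thesis .
  qed
  then show ?thesis by simp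
qed

lemma hyperbolic_sink_system: "hyperbolic_sink Discrete 2 system rest"
  unfolding hyperbolic_sink_def sink_def
proof (intro conjI allI impI)
  have "rot 1 = (1 :: real)" by (simp add: rot_def)
  then show "fixed_point Discrete 2 system rest"
    by (auto simp: system_def rest_def weight_0)
  have "x \<in> basin Discrete 2 system rest" if x: "x \<in> carrier_vec 2" "edist x rest < 1" for x
  proof -
    have "\<bar>x $ 0\<bar> < 1" "\<bar>x $ 1 - 1\<bar> < 1"
      using abs_le_edist[OF x(1), of rest] x(2) by (auto simp: rest_def)
    \<comment> \<open>Zeros of the weight lie at some \<open>2 ^ (e + 2)\<close>, outside the unit
      ball around the sink.\<close>
    moreover have "1 \<le> (2 :: real) ^ (e + 2)" for e by (rule one_le_power) simp
    ultimately show ?thesis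
      unfolding basin_system using x(1) weight_eq_0_iff[OF bits_nonneg bits_le_1, where x = "x $ 0"]
      by (auto simp: abs_less_iff) (smt (verit))
  qed
  then show "\<exists>\<epsilon>>0. \<forall>x\<in>carrier_vec 2. edist x rest < \<epsilon> \<longrightarrow> x \<in> basin Discrete 2 system rest"
    by (intro exI[of _ 1]) auto
  fix \<mu>
  assume "eigenvalue (map_mat complex_of_real (Defs.jacobian 2 system rest)) \<mu>"
  then obtain v where v: "v \<in> carrier_vec 2" "v \<noteq> 0\<^sub>v 2"
    "map_mat complex_of_real (Defs.jacobian 2 system rest) *\<^sub>v v = \<mu> \<cdot>\<^sub>v v"
    by (auto simp: eigenvalue_def eigenvector_def Defs.jacobian_def)
  have "((\<lambda>t. rot (1 + t)) has_real_derivative 0) (at 0)"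
    unfolding rot_def by (auto intro!: derivative_eq_intros)
  then have d: "deriv (\<lambda>t. rot (1 + t)) 0 = (0 :: real)" by (rule DERIV_imp_deriv)
  \<comment> \<open>The entry \<open>w\<close> stays symbolic: the Jacobian is strictly lower
    triangular, so 0 is its only eigenvalue.\<close>
  define w where "w = Defs.jacobian 2 system rest $$ (1, 0)"
  have J: "Defs.jacobian 2 system rest $$ (0, 0) = 0" "Defs.jacobian 2 system rest $$ (0, 1) = 0"
    "Defs.jacobian 2 system rest $$ (1, 1) = 0"
    using d by (simp_all add: Defs.jacobian_def system_def rest_def weight_0 cong: if_cong)
  have dim: "Defs.jacobian 2 system rest \<in> carrier_mat 2 2" by (simp add: Defs.jacobian_def)
  have "\<mu> * v $ 0 = 0" "\<mu> * v $ 1 = of_real w * v $ 0"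
    using arg_cong[OF v(3), of "\<lambda>v. v $ 0"] arg_cong[OF v(3), of "\<lambda>v. v $ 1"] v(1) dim J
    by (auto simp: scalar_prod_def w_def numeral_2_eq_2)
  moreover have "v $ 0 \<noteq> 0 \<or> v $ 1 \<noteq> 0"
  proof (rule ccontr)
    assume "\<not> (v $ 0 \<noteq> 0 \<or> v $ 1 \<noteq> 0)"
    then have "v = 0\<^sub>v 2" using v(1) by (intro eq_vecI) (auto simp: less_Suc_eq numeral_2_eq_2)
    then show False using v(2) by simp
  qed
  ultimately show "stable_eigenvalue Discrete \<mu>" by auto
qed

definition site :: "nat \<Rightarrow> real vec" where
  "site e = vec 2 (\<lambda>i. real (location e i))"

lemma set_distance_site:
  defines "A \<equiv> carrier_vec 2 - basin Discrete 2 system rest"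
  shows "bits e = 0 \<Longrightarrow> set_distance A (site e) = 0" "bits e \<noteq> 0 \<Longrightarrow> 2 \<le> set_distance A (site e)"
proof -
  have A: "A = {v \<in> carrier_vec 2. v $ 1 \<le> 0 \<or> (\<exists>e. v $ 0 = 2 ^ (e + 2) \<and> bits e = 0)}"
    unfolding A_def basin_system using weight_eq_0_iff[OF bits_nonneg bits_le_1] by (auto simp: not_less)
  have site: "site e \<in> carrier_vec 2" "site e $ 0 = 2 ^ (e + 2)" "site e $ 1 = 2"
    by (auto simp: site_def location_def)
  have nonneg: "0 \<le> edist x y" for x y by (simp add: edist_def sum_nonneg)
  then have bdd: "bdd_below (edist (site e) ` A)" by (auto simp: bdd_below_def)
  {
    assume "bits e = 0"
    then have "site e \<in> A" using site by (auto simp: A)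
    then have "(INF y\<in>A. edist (site e) y) \<le> edist (site e) (site e)" by (rule cINF_lower[OF bdd])
    moreover have "0 \<le> (INF y\<in>A. edist (site e) y)"
      using \<open>site e \<in> A\<close> nonneg by (intro cINF_greatest) auto
    ultimately show "set_distance A (site e) = 0"
      using \<open>site e \<in> A\<close> by (auto simp: set_distance_def edist_def)
  next
    assume e: "bits e \<noteq> 0"
    \<comment> \<open>Rules out the empty complement, whose distance is 0 by convention.\<close>
    have "0\<^sub>v 2 \<in> A" by (simp add: A)
    moreover have "2 \<le> edist (site e) y" if y: "y \<in> A" for y
    proof (cases "y $ 1 \<le> 0")
      case True
      then show ?thesis using abs_le_edist(2)[OF site(1), of y] site(3) by linarith
    next
      case False
      then obtain e' where e': "y $ 0 = 2 ^ (e' + 2)" "e' \<noteq> e" using y e by (auto simp: A)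
      have "4 \<le> \<bar>(2 :: real) ^ (e + 2) - 2 ^ (e' + 2)\<bar>"
      proof -
        have "4 \<le> (2 :: real) ^ (k + 2) - 2 ^ (j + 2)" if "j < k" for j k
        proof -
          have "(2 :: real) ^ Suc j \<le> 2 ^ k" using that by (intro power_increasing) auto
          moreover have "1 \<le> (2 :: real) ^ j" by (rule one_le_power) simp
          moreover have "(2 :: real) ^ (k + 2) = 4 * 2 ^ k" "(2 :: real) ^ (j + 2) = 4 * 2 ^ j" by simp_all
          ultimately show ?thesis unfolding power_Suc by linarith
        qed
        from this[of e e'] this[of e' e] e'(2) show ?thesis by linarith
      qed
      then show ?thesis using abs_le_edist(1)[OF site(1), of y] site(2) e'(1) by linarith
    qed
    ultimately show "2 \<le> set_distance A (site e)"
      by (auto simp: set_distance_def intro!: cINF_greatest)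
  }
qed

text \<open>Run on input 0, the machine errs by less than 1. An output below 1 is accepted and makes
  \<open>bits e\<close> positive, so the distance is at least 2; any other output leaves
  \<open>bits e = 0\<close> and the distance 0. Either way the machine is wrong.\<close>

lemma not_computable_basin: "\<not> computable_open_set 2 (basin Discrete 2 system rest)"
proof
  define A where "A = carrier_vec 2 - basin Discrete 2 system rest"
  assume comp: "computable_open_set 2 (basin Discrete 2 system rest)"
  obtain M where M: "oracle_machine 2 M"
    and out: "\<forall>x\<in>carrier_vec 2. \<forall>\<phi>. is_oracle_vec 2 \<phi> x \<longrightarrow> (\<forall>k. \<exists>qs. outputs M \<phi> k qs \<and> length qs = 1 \<and>
      (\<forall>i<1. \<bar>of_rat (qs ! i) - vec 1 (\<lambda>_. set_distance A x) $ i\<bar> < 1 / 2 ^ k))"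
    using comp unfolding computable_open_set_def computable_function_def A_def[symmetric]
    by (elim exE conjE) (rule that)
  obtain e where e: "codes M e" using ex_codes by blast
  have "site e \<in> carrier_vec 2" by (simp add: site_def)
  moreover have "is_oracle_vec 2 (\<lambda>i k. of_nat (location e i)) (site e)"
    by (simp add: is_oracle_vec_def is_oracle_def site_def)
  ultimately obtain qs where qs: "outputs M (\<lambda>i k. of_nat (location e i)) 0 qs" "length qs = 1"
    "\<bar>of_rat (qs ! 0) - set_distance A (site e)\<bar> < 1"
    using out[rule_format, of "site e" "\<lambda>i k. of_nat (location e i)" 0] by auto
  define q where "q = qs ! 0"
  have "qs = [q]" using qs(2) by (cases qs) (auto simp: q_def)
  then have acc: "(\<exists>t. accepts e t) \<longleftrightarrow> q < 1" using accepts_iff[OF e M] qs(1) by simp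
  have dist: "\<bar>of_rat q - set_distance A (site e)\<bar> < 1" using qs(3) by (simp add: q_def)
  have less: "q < 1 \<longleftrightarrow> of_rat q < (1 :: real)"
    using of_rat_less[of q 1, where 'a = real] by simp
  show False
  proof (cases "bits e = 0")
    case True
    then have "\<not> real_of_rat q < 1" using bits_eq_0_iff[of e] acc less by blast
    moreover have "set_distance A (site e) = 0" unfolding A_def by (rule set_distance_site(1)[OF True])
    ultimately show False using dist by linarith
  next
    case False
    then have "real_of_rat q < 1" using bits_eq_0_iff[of e] acc less by blast
    moreover have "2 \<le> set_distance A (site e)" unfolding A_def by (rule set_distance_site(2)[OF False])
    ultimately show False using dist by linarith
  qed
qed

theorem theorem2p5:
  shows "\<exists>n::nat. n \<ge> 1 \<and>
    (\<exists>(T :: time) (f :: real vec \<Rightarrow> real vec) (s :: real vec).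
       f \<in> carrier_vec n \<rightarrow> carrier_vec n \<and>
       real_analytic n n f \<and>
       computable_function n n f \<and>
       computable_point n s \<and>
       hyperbolic_sink T n f s \<and>
       \<not> computable_open_set n (basin T n f s))"
proof (intro exI conjI)
  show "(1 :: nat) \<le> 2" by simp
  show "system \<in> carrier_vec 2 \<rightarrow> carrier_vec 2" by (auto simp: system_def)
  show "computable_point 2 rest" by (rule computable_point_0_1) (simp_all add: rest_def)
qed (fact real_analytic_system computable_system hyperbolic_sink_system not_computable_basin)+

end
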